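(* Let $\Gamma\subset\mathrm{PSL}_2(\mathbb R)$ be a cocompact Fuchsian group such that the genus $g$ of $X=\Gamma\backslash\mathbb H$ satisfies $g\ge2$ (with or without elliptic points). Then there is no holomorphic function $E$ on $\mathbb H$ satisfying $$E|_2\gamma=E+c\,X(\gamma,\tau)\qquad\text{for all }\gamma\in\Gamma$$ for any nonzero constant $c$. Equivalently, $Q_1\equiv0$ on $Q_2(\Gamma)$, i.e. $Q_2(\Gamma)=M_2(\Gamma)$.
   Context: For $\gamma=\begin{pmatrix}a&b\\c&d\end{pmatrix}\in\mathrm{SL}_2(\mathbb R)$: $j(\gamma,\tau)=c\tau+d$, $X(\gamma,\tau)=c/j(\gamma,\tau)$ (here $c$ is the matrix entry), and $f|_k\gamma(\tau)=j(\gamma,\tau)^{-k}f(\gamma\tau)$. Elements of $\Gamma$ are lifted to $\mathrm{SL}_2(\mathbb R)$. For cocompact $\Gamma$ (no cusps), $M_k(\Gamma)$ is the space of holomorphic $f:\mathbb H\to\mathbb C$ with $f|_k\gamma=f$ for all $\gamma\in\Gamma$. $Q_k(\Gamma)$ is the space of holomorphic $f:\mathbb H\to\mathbb C$ for which there are $s\ge0$ and holomorphic functions $Q_0(f),\dots,Q_s(f)$ on $\mathbb H$ with $f|_k\gamma(\tau)=\sum_{m=0}^sX(\gamma,\tau)^mQ_m(f)(\tau)$ for all $\gamma\in\Gamma$ (quasi-automorphic forms of weight $k$ and depth $\le s$; the $Q_m(f)$ are uniquely determined and $Q_0(f)=f$). *)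

theory Defs
  imports "HOL-Complex_Analysis.Complex_Analysis" "HOL-Homology.Homology"
begin

section \<open>The upper half plane and the slash operator\<close>

definition upper_half_plane :: "complex set" (\<open>\<H>\<close>)
  where "\<H> = {\<tau>. Im \<tau> > 0}"

definition act :: "real^2^2 \<Rightarrow> complex \<Rightarrow> complex"
  where "act \<gamma> = moebius (of_real (\<gamma>$1$1)) (of_real (\<gamma>$1$2)) (of_real (\<gamma>$2$1)) (of_real (\<gamma>$2$2))"

definition J :: "real^2^2 \<Rightarrow> complex \<Rightarrow> complex"
  where "J \<gamma> \<tau> = of_real (\<gamma>$2$1) * \<tau> + of_real (\<gamma>$2$2)"

definition X_cocycle :: "real^2^2 \<Rightarrow> complex \<Rightarrow> complex"
  where "X_cocycle \<gamma> \<tau> = of_real (\<gamma>$2$1) / J \<gamma> \<tau>"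

definition slash :: "int \<Rightarrow> (complex \<Rightarrow> complex) \<Rightarrow> real^2^2 \<Rightarrow> complex \<Rightarrow> complex"
  where "slash k f \<gamma> \<tau> = J \<gamma> \<tau> powi (- k) * f (act \<gamma> \<tau>)"


section \<open>Quotient topologies\<close>

text \<open>For a partition \<open>P\<close> of the space underlying \<open>T\<close>, this is the quotient topology on \<open>P\<close>:
  a set of classes is open iff the union of these classes is open in \<open>T\<close>.\<close>

definition partition_topology :: "'a topology \<Rightarrow> 'a set set \<Rightarrow> 'a set topology"
  where "partition_topology T P = topology (\<lambda>U. U \<subseteq> P \<and> openin T (\<Union>U))"

lemma openin_partition_topology:
  assumes "disjoint P"
  shows "openin (partition_topology T P) U \<longleftrightarrow> U \<subseteq> P \<and> openin T (\<Union>U)"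
proof -
  have "istopology (\<lambda>U. U \<subseteq> P \<and> openin T (\<Union>U))"
    unfolding istopology_def
  proof (intro conjI allI impI; (elim conjE)?)
    fix S S' assume *: "S \<subseteq> P" "S' \<subseteq> P" "openin T (\<Union>S)" "openin T (\<Union>S')"
    have "\<Union>(S \<inter> S') = \<Union>S \<inter> \<Union>S'"
    proof
      show "\<Union>S \<inter> \<Union>S' \<subseteq> \<Union>(S \<inter> S')"
      proof
        fix x assume "x \<in> \<Union>S \<inter> \<Union>S'"
        then obtain A B where "A \<in> S" "B \<in> S'" "x \<in> A" "x \<in> B" by blast
        moreover from this have "A = B"
          using assms * unfolding pairwise_def disjnt_def by blast
        ultimately show "x \<in> \<Union>(S \<inter> S')" by blast
      qed
    qed blast
    then show "openin T (\<Union>(S \<inter> S'))" using * by auto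
  next
    fix K assume "\<forall>S\<in>K. S \<subseteq> P \<and> openin T (\<Union>S)"
    moreover have "\<Union>(\<Union>K) = (\<Union>S\<in>K. \<Union>S)" by blast
    ultimately show "openin T (\<Union>(\<Union>K))" by auto
  qed blast+
  then show ?thesis
    by (simp add: partition_topology_def topology_inverse')
qed


section \<open>Cocompact Fuchsian groups\<close>

definition SL2R :: "(real^2^2) monoid"
  where "SL2R = \<lparr>carrier = {A. det A = 1}, monoid.mult = (**), one = mat 1\<rparr>"

definition PSL2R :: "(real^2^2) set monoid"
  where "PSL2R = SL2R Mod {mat 1, - mat 1}"

lemma group_SL2R: "group SL2R"
proof (rule groupI)
  fix A assume "A \<in> carrier SL2R"
  then have d: "det A = 1" by (simp add: SL2R_def)
  then have "invertible A" by (simp add: invertible_det_nz)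
  then obtain B where B: "A ** B = mat 1" "B ** A = mat 1" unfolding invertible_def by blast
  then have "det B = 1" using det_mul[of A B] d by (simp add: det_I)
  then show "\<exists>B\<in>carrier SL2R. B \<otimes>\<^bsub>SL2R\<^esub> A = \<one>\<^bsub>SL2R\<^esub>"
    using B by (auto simp: SL2R_def)
qed (auto simp: SL2R_def det_mul matrix_mul_assoc det_I)

lemma normal_SL2R_centre: "{mat 1, - mat 1} \<lhd> SL2R"
proof -
  interpret group SL2R by (rule group_SL2R)
  have neg: "- mat 1 ** A = - A" "A ** - mat 1 = - A" for A :: "real^2^2"
    by (simp_all add: vec_eq_iff matrix_matrix_mult_def sum_2 forall_2 mat_def)
  have inv1: "inv\<^bsub>SL2R\<^esub> (- mat 1) = - mat 1"
  proof (rule inv_equality)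
    show "- mat 1 \<otimes>\<^bsub>SL2R\<^esub> - mat 1 = \<one>\<^bsub>SL2R\<^esub>"
      by (simp add: SL2R_def neg)
  qed (simp_all add: SL2R_def det_2 mat_def)
  have "subgroup {mat 1, - mat 1} SL2R"
  proof (rule subgroupI)
    fix a assume "a \<in> {mat 1, - mat 1 :: real^2^2}"
    then show "inv\<^bsub>SL2R\<^esub> a \<in> {mat 1, - mat 1}"
      using inv1 inv_one by (auto simp: SL2R_def)
  next
    show "{mat 1, - mat 1} \<subseteq> carrier SL2R"
      by (simp add: SL2R_def det_2 mat_def)
  qed (auto simp: SL2R_def neg)
  moreover have "{mat 1, - mat 1} #>\<^bsub>SL2R\<^esub> A = A <#\<^bsub>SL2R\<^esub> {mat 1, - mat 1}" for A
    by (simp add: r_coset_def l_coset_def SL2R_def neg)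
  ultimately show ?thesis by (auto intro: normalI)
qed

definition PSL2R_topology :: "(real^2^2) set topology"
  where "PSL2R_topology = partition_topology (top_of_set (carrier SL2R)) (carrier PSL2R)"

definition fuchsian :: "(real^2^2) set set \<Rightarrow> bool"
  where "fuchsian \<Gamma> \<longleftrightarrow> subgroup \<Gamma> PSL2R \<and> subtopology PSL2R_topology \<Gamma> = discrete_topology \<Gamma>"

text \<open>The elements of \<open>\<Gamma>\<close> are cosets \<open>{A, - A}\<close>, so \<open>\<Union>\<Gamma>\<close> is the set of all lifts to
  \<open>SL\<^sub>2(\<real>)\<close> of elements of \<open>\<Gamma>\<close>.\<close>

definition orbit_of :: "(real^2^2) set set \<Rightarrow> complex \<Rightarrow> complex set"
  where "orbit_of \<Gamma> \<tau> = {act \<gamma> \<tau> |\<gamma>. \<gamma> \<in> \<Union>\<Gamma>}"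

definition orbit_space :: "(real^2^2) set set \<Rightarrow> complex set topology"
  where "orbit_space \<Gamma> = partition_topology (top_of_set \<H>) (orbit_of \<Gamma> ` \<H>)"

definition cocompact :: "(real^2^2) set set \<Rightarrow> bool"
  where "cocompact \<Gamma> \<longleftrightarrow> compact_space (orbit_space \<Gamma>)"

text \<open>The genus of a closed orientable surface \<open>S\<close> is half its first Betti number:
  the first integral homology group of \<open>S\<close> is free abelian of rank \<open>2 * g\<close>.\<close>

definition has_genus :: "'a topology \<Rightarrow> nat \<Rightarrow> bool"
  where "has_genus S g \<longleftrightarrow> homology_group 1 S \<cong> free_Abelian_group {..<2 * g}"


section \<open>Automorphic and quasi-automorphic forms\<close>

text \<open>Both spaces are for groups without cusps, so no growth condition is imposed.  Functions on
  \<open>\<H>\<close> are represented by functions on \<open>\<complex>\<close> whose values outside \<open>\<H>\<close> are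
  irrelevant.  All lifts of elements of \<open>\<Gamma>\<close> are used; for even \<open>k\<close> the transformation laws
  do not depend on the lift.\<close>

definition automorphic_forms :: "int \<Rightarrow> (real^2^2) set set \<Rightarrow> (complex \<Rightarrow> complex) set"
  where "automorphic_forms k \<Gamma> =
    {f. f holomorphic_on \<H> \<and> (\<forall>\<gamma>\<in>\<Union>\<Gamma>. \<forall>\<tau>\<in>\<H>. slash k f \<gamma> \<tau> = f \<tau>)}"

text \<open>\<open>Q 0, \<dots>, Q s\<close> are functions \<open>Q\<^sub>0(f), \<dots>, Q\<^sub>s(f)\<close> witnessing that \<open>f\<close> is
  quasi-automorphic of weight \<open>k\<close> and depth at most \<open>s\<close>.  The values \<open>Q m\<close> for
  \<open>m > s\<close> carry no information.\<close>

definition quasi_expansion ::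
  "int \<Rightarrow> (real^2^2) set set \<Rightarrow> (complex \<Rightarrow> complex) \<Rightarrow> nat \<Rightarrow> (nat \<Rightarrow> complex \<Rightarrow> complex) \<Rightarrow> bool"
  where "quasi_expansion k \<Gamma> f s Q \<longleftrightarrow>
    (\<forall>m\<le>s. Q m holomorphic_on \<H>) \<and>
    (\<forall>\<gamma>\<in>\<Union>\<Gamma>. \<forall>\<tau>\<in>\<H>. slash k f \<gamma> \<tau> = (\<Sum>m\<le>s. X_cocycle \<gamma> \<tau> ^ m * Q m \<tau>))"

definition quasi_automorphic_forms :: "int \<Rightarrow> (real^2^2) set set \<Rightarrow> (complex \<Rightarrow> complex) set"
  where "quasi_automorphic_forms k \<Gamma> =
    {f. f holomorphic_on \<H> \<and> (\<exists>s Q. quasi_expansion k \<Gamma> f s Q)}"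

end

theory Submission
  imports Defs
begin

text \<open>
Why there is no such \<open>E\<close>.  Dividing by \<open>c\<close>, suppose that \<open>E\<close> solves the equation with constant 1.  Since
\<open>E\<close> has a primitive \<open>g\<close> on \<open>\<H>\<close>, one can form the real function \<open>u = 2 * Re g + ln Im\<close>.  The equation for
\<open>E\<close> says exactly that the differences \<open>u w - u p\<close> are invariant under the group
(\<open>potential_act\<close>).  If \<open>u\<close> itself were invariant, it would attain its minimum, contradicting that it is
strictly superharmonic.  In general the differential of \<open>u\<close> descends to a closed form on the compact
quotient while the hyperbolic Laplacian of \<open>u\<close> is a nonzero constant, and one would integrate by Stokes'
theorem.

Here this integration is carried out without derivatives, fundamental domains or smooth partitions of
unity.  By the mean value property the integral of \<open>u w - u p\<close> over the hyperbolic disc of a fixed radius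
about \<open>p\<close> is the same negative number for every \<open>p\<close> (\<open>hyp_disc_average\<close>).  On the other hand
\<open>u w - u p\<close> is antisymmetric in \<open>p\<close> and \<open>w\<close>, and the condition that \<open>w\<close> lies in the disc about \<open>p\<close> is
symmetric and invariant.  Integrating over pairs of points modulo the group therefore gives zero
(\<open>integral_weight_antisymmetric\<close>).  The integration modulo the group is expressed by a weight function
with relatively compact support whose translates sum to 1.  This contradiction is
\<open>no_quasiautomorphic_cocycle\<close>.

For the statements on quasi-automorphic forms, one first needs that the coefficients \<open>Q m\<close> are unique,
that is, that \<open>X_cocycle A \<tau>\<close> takes infinitely many values.  This also follows from the result on \<open>E\<close>: if
there were only finitely many functions \<open>X_cocycle A\<close>, minus their mean would be a solution
(\<open>infinite_X_functions\<close>).  Comparing leading coefficients then shows that \<open>Q s\<close> is automorphic of weight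
\<open>2 - 2 * s\<close>.  For \<open>s > 1\<close> it vanishes by the maximum principle, for \<open>s = 1\<close> it is a constant and vanishes
by the result on \<open>E\<close>; induction on the depth removes all higher coefficients
(\<open>quasi_coefficients_vanish\<close>).
\<close>

text \<open>The dollar sign is reserved for the entries of vectors and matrices.\<close>

no_notation fps_nth (infixl \<open>$\<close> 75)

section \<open>Holomorphic change of variables\<close>

text \<open>The substitution rule for differentiable maps concerns \<open>real^2\<close>, so \<open>\<complex>\<close> is identified
with \<open>real^2\<close> by an isometry that carries Lebesgue measure to Lebesgue measure.\<close>

definition vec2 :: "complex \<Rightarrow> real^2" where "vec2 z = vector [Re z, Im z]"
definition unvec2 :: "real^2 \<Rightarrow> complex" where "unvec2 v = Complex (v$1) (v$2)"

lemma vec2_inverse [simp]: "unvec2 (vec2 z) = z" "vec2 (unvec2 v) = v"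
  by (simp_all add: vec2_def unvec2_def vec_eq_iff forall_2)

lemma linear_vec2: "linear vec2"
  by (rule linearI) (simp_all add: vec2_def vec_eq_iff forall_2)

lemma linear_unvec2: "linear unvec2"
  by (rule linearI) (simp_all add: unvec2_def complex_eq_iff)

lemma measurable_unvec2 [measurable]: "unvec2 \<in> borel_measurable borel"
  by (intro borel_measurable_continuous_onI linear_continuous_on linear_conv_bounded_linear[THEN iffD1] linear_unvec2)

lemma distr_lborel_vec2: "distr lborel borel unvec2 = (lborel :: complex measure)"
proof (rule lborel_eqI[symmetric])
  fix l u :: complex
  assume b: "\<And>b. b \<in> Basis \<Longrightarrow> l \<bullet> b \<le> u \<bullet> b"
  have le: "Re l \<le> Re u" "Im l \<le> Im u"
    using b[of 1] b[of \<i>] by (simp_all add: Basis_complex_def)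
  have B2: "(Basis :: (real^2) set) = {axis 1 1, axis 2 1}"
    unfolding Basis_vec_def by (auto simp: UNIV_2)
  have pre: "unvec2 -` box l u = box (vec2 l) (vec2 u)"
    by (simp add: box_def B2 Basis_complex_def vec2_def unvec2_def inner_axis vimage_def)
  have "emeasure lborel (box (vec2 l) (vec2 u)) = (\<Prod>b\<in>Basis. (vec2 u - vec2 l) \<bullet> b)"
    by (rule emeasure_lborel_box) (use le in \<open>auto simp: B2 vec2_def inner_axis\<close>)
  also have "(\<Prod>b\<in>Basis. (vec2 u - vec2 l) \<bullet> b) = (\<Prod>b\<in>Basis. (u - l) \<bullet> b)"
    by (simp add: B2 Basis_complex_def vec2_def inner_axis axis_eq_axis)
  finally show "emeasure (distr lborel borel unvec2) (box l u) = (\<Prod>b\<in>Basis. (u - l) \<bullet> b)"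
    by (simp add: emeasure_distr pre)
qed simp

lemma integral_lborel_vec2:
  fixes g :: "complex \<Rightarrow> real"
  assumes [measurable]: "g \<in> borel_measurable borel"
  shows "(\<integral>z. g z \<partial>lborel) = (\<integral>v. g (unvec2 v) \<partial>lborel)"
  by (subst distr_lborel_vec2[symmetric], subst integral_distr) simp_all

text \<open>The Jacobian of a holomorphic map is the squared norm of its derivative, because multiplication by
\<open>c\<close> is a rotation followed by scaling with \<open>norm c\<close>.\<close>

lemma det_complex_mult: "det (matrix (\<lambda>v. vec2 (c * unvec2 v))) = (norm c)\<^sup>2"
  by (simp add: det_2 matrix_def vec2_def unvec2_def axis_def cmod_power2) (simp add: power2_eq_square)

text \<open>An integrand and its pullback are integrable together, and if they are not, both Bochner integrals are
zero by convention; so the identity holds for every measurable \<open>g\<close>.\<close>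

theorem integral_holomorphic_substitution:
  fixes g :: "complex \<Rightarrow> real" and f f' :: "complex \<Rightarrow> complex"
  assumes [measurable]: "g \<in> borel_measurable borel" "f \<in> borel_measurable borel"
      "f' \<in> borel_measurable borel" "S \<in> sets borel" "f ` S \<in> sets borel"
    and der: "\<And>z. z \<in> S \<Longrightarrow> (f has_field_derivative f' z) (at z)"
    and inj: "inj_on f S"
  shows "(\<integral>z. indicator (f ` S) z * g z \<partial>lborel)
       = (\<integral>z. indicator S z * ((norm (f' z))\<^sup>2 * g (f z)) \<partial>lborel)"
proof -
  let ?S = "unvec2 -` S"
  let ?F = "\<lambda>v. vec2 (f (unvec2 v))"
  let ?F' = "\<lambda>v w. vec2 (f' (unvec2 v) * unvec2 w)"
  let ?G = "\<lambda>v. vec (g (unvec2 v)) :: real^1"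
  let ?D = "\<lambda>v. \<bar>det (matrix (?F' v))\<bar> *\<^sub>R ?G (?F v)"
  have S[measurable]: "?S \<in> sets borel"
    using measurable_sets[OF measurable_unvec2, of S] by simp
  have img: "?F ` ?S = unvec2 -` (f ` S)"
  proof (intro subset_antisym subsetI)
    fix v assume "v \<in> unvec2 -` (f ` S)" 
    then obtain z where z: "z \<in> S" "unvec2 v = f z" by auto
    then have "v = ?F (vec2 z)" by (metis vec2_inverse)
    then show "v \<in> ?F ` ?S"
      using z by (intro image_eqI[of _ _ "vec2 z"]) simp_all
  qed auto
  have img_meas[measurable]: "?F ` ?S \<in> sets borel"
    using measurable_sets[OF measurable_unvec2, of "f ` S"] by (simp add: img)
  have inj': "inj_on ?F ?S"
    using inj unfolding inj_on_def by (metis vec2_inverse vimageE)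
  have der': "(?F has_derivative ?F' v) (at v within ?S)" if "v \<in> ?S" for v
  proof -
    have 1: "(f has_derivative (*) (f' (unvec2 v))) (at (unvec2 v))"
      using der[of "unvec2 v"] that by (simp add: has_field_derivative_def)
    have 2: "(unvec2 has_derivative unvec2) (at v within ?S)"
      by (intro linear_imp_has_derivative linear_unvec2)
    have 3: "(vec2 has_derivative vec2) (at (f (unvec2 v)))"
      by (intro linear_imp_has_derivative linear_vec2)
    from has_derivative_compose[OF has_derivative_compose[OF 2 1] 3] show ?thesis .
  qed
  have "S \<in> sets borel" by fact
  have cov: "?D absolutely_integrable_on ?S \<and> integral ?S ?D = b
     \<longleftrightarrow> ?G absolutely_integrable_on (?F ` ?S) \<and> integral (?F ` ?S) ?G = b" for b
    by (rule has_absolute_integral_change_of_variables[OF _ der' inj']) (use S in auto)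
  \<comment> \<open>The substitution rule speaks of absolute integrability and the gauge integral of functions with
    values in a Cartesian space; this translates both to Bochner integrals.\<close>
  have conv: "(\<integral>v. indicator T v * h v \<partial>lborel) = 
      (if (\<lambda>v. vec (h v) :: real^1) absolutely_integrable_on T then integral T (\<lambda>v. vec (h v) :: real^1) $ 1 else 0)"
    if [measurable]: "T \<in> sets borel" "h \<in> borel_measurable borel" for T and h :: "real^2 \<Rightarrow> real"
  proof -
    have iff: "(\<lambda>v. vec (h v) :: real^1) absolutely_integrable_on T \<longleftrightarrow> integrable lborel (\<lambda>v. indicator T v * h v)"
    proof -
      have "(\<lambda>v. vec (h v) :: real^1) absolutely_integrable_on T \<longleftrightarrow> h absolutely_integrable_on T"
        by (simp add: absolutely_integrable_on_1_iff)
      also have "\<dots> \<longleftrightarrow> integrable lborel (\<lambda>v. indicator T v * h v)"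
        by (simp add: set_integrable_def integrable_completion)
      finally show ?thesis .
    qed
    show ?thesis
    proof (cases "integrable lborel (\<lambda>v. indicator T v * h v)")
      case True
      then have hi: "h absolutely_integrable_on T"
        by (simp add: set_integrable_def integrable_completion)
      have "(\<integral>v. indicator T v * h v \<partial>lborel) = integral T h"
        using set_lebesgue_integral_eq_integral(2)[OF hi]
        by (simp add: set_lebesgue_integral_def integral_completion)
      moreover have "integral T (\<lambda>v. vec (h v) :: real^1) $ 1 = integral T h"
        using integral_on_1_eq[of T "\<lambda>v. vec (h v) :: real^1"] by simp
      ultimately show ?thesis using True iff by simp
    next
      case False
      then show ?thesis using iff by (simp add: not_integrable_integral_eq)
    qed
  qed
  have "(\<integral>z. indicator (f ` S) z * g z \<partial>lborel) = (\<integral>v. indicator (?F ` ?S) v * g (unvec2 v) \<partial>lborel)"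
    by (subst integral_lborel_vec2) (simp_all add: img indicator_def)
  also have "\<dots> = (\<integral>v. indicator ?S v * ((norm (f' (unvec2 v)))\<^sup>2 * g (f (unvec2 v))) \<partial>lborel)"
  proof -
    have D: "?D = (\<lambda>v. vec ((norm (f' (unvec2 v)))\<^sup>2 * g (f (unvec2 v))) :: real^1)"
      by (rule ext) (simp add: det_complex_mult vec_eq_iff)
    show ?thesis
      using cov[unfolded D, of "integral (?F ` ?S) ?G"]
        cov[unfolded D, of "integral ?S (\<lambda>v. vec ((norm (f' (unvec2 v)))\<^sup>2 * g (f (unvec2 v))))"]
      by (subst (1 2) conv) auto
  qed
  also have "\<dots> = (\<integral>z. indicator S z * ((norm (f' z))\<^sup>2 * g (f z)) \<partial>lborel)"
    by (subst integral_lborel_vec2) (simp_all add: indicator_def)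
  finally show ?thesis .
qed

section \<open>The action on the upper half plane\<close>

lemma J_nonzero:
  assumes "det A = 1" "\<tau> \<in> \<H>" shows "J A \<tau> \<noteq> 0"
proof
  assume "J A \<tau> = 0"
  then have "Re (J A \<tau>) = 0" "Im (J A \<tau>) = 0" by simp_all
  then have "A$2$1 = 0" "A$2$2 = 0"
    using assms by (auto simp: J_def upper_half_plane_def)
  then show False using assms(1) by (simp add: det_2)
qed

text \<open>Powers of this factor \<open>norm (J A \<tau>)\<close> compensate those in the transformation of forms, of area and of
the potential below.\<close>

lemma Im_act:
  assumes "det A = 1" "\<tau> \<in> \<H>"
  shows "Im (act A \<tau>) = Im \<tau> / (norm (J A \<tau>))\<^sup>2"
proof -
  have d: "A$1$1 * A$2$2 - A$1$2 * A$2$1 = 1" using assms(1) by (simp add: det_2)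
  have "Im (act A \<tau>) = (A$1$1 * Im \<tau> * (A$2$1 * Re \<tau> + A$2$2) - (A$1$1 * Re \<tau> + A$1$2) * (A$2$1 * Im \<tau>)) / (norm (J A \<tau>))\<^sup>2"
    by (simp add: act_def moebius_def Im_divide J_def cmod_power2)
  also have "A$1$1 * Im \<tau> * (A$2$1 * Re \<tau> + A$2$2) - (A$1$1 * Re \<tau> + A$1$2) * (A$2$1 * Im \<tau>)
      = Im \<tau> * (A$1$1 * A$2$2 - A$1$2 * A$2$1)" by (simp add: algebra_simps)
  finally show ?thesis by (simp add: d)
qed

lemma act_in_H: "det A = 1 \<Longrightarrow> \<tau> \<in> \<H> \<Longrightarrow> act A \<tau> \<in> \<H>"
  using Im_act[of A \<tau>] J_nonzero[of A \<tau>] by (simp add: upper_half_plane_def)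

lemma matrix_mult_2:
  fixes A B :: "real^2^2"
  shows "(A ** B)$i$j = A$i$1 * B$1$j + A$i$2 * B$2$j"
  by (simp add: matrix_matrix_mult_def sum_2)

lemma J_mult:
  assumes "det B = 1" "\<tau> \<in> \<H>"
  shows "J (A ** B) \<tau> = J A (act B \<tau>) * J B \<tau>"
  using J_nonzero[OF assms]
  by (simp add: J_def matrix_mult_2 act_def moebius_def field_simps)

lemma act_mult:
  assumes "det A = 1" "det B = 1" "\<tau> \<in> \<H>"
  shows "act (A ** B) \<tau> = act A (act B \<tau>)"
proof -
  have *: "act A \<tau> = (of_real (A$1$1) * \<tau> + of_real (A$1$2)) / J A \<tau>" for A \<tau>
    by (simp add: act_def moebius_def J_def)
  have n: "J B \<tau> \<noteq> 0" "J A (act B \<tau>) \<noteq> 0"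
    using assms J_nonzero act_in_H by auto
  have "(of_real (A$1$1) * act B \<tau> + of_real (A$1$2)) * J B \<tau>
      = of_real ((A ** B)$1$1) * \<tau> + of_real ((A ** B)$1$2)"
    using n(1) by (simp add: *[of B \<tau>] field_simps matrix_mult_2) (simp add: J_def algebra_simps)
  then show ?thesis
    using n assms by (simp add: *[of "A ** B"] *[of A "act B \<tau>"] J_mult divide_simps)
qed

lemma act_mat_1 [simp]: "act (mat 1) \<tau> = \<tau>"
  by (simp add: act_def moebius_def mat_def)

lemma J_mat_1 [simp]: "J (mat 1) \<tau> = 1"
  by (simp add: J_def mat_def)

text \<open>\<open>X_cocycle\<close> is a cocycle of weight two, as it is the logarithmic derivative of the factor of
automorphy \<open>J\<close>, which is multiplicative by \<open>J_mult\<close>.\<close>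

lemma X_mult:
  assumes "det A = 1" "det B = 1" "\<tau> \<in> \<H>"
  shows "X_cocycle (A ** B) \<tau> = X_cocycle A (act B \<tau>) / (J B \<tau>)\<^sup>2 + X_cocycle B \<tau>"
proof -
  have n: "J B \<tau> \<noteq> 0" "J A (act B \<tau>) \<noteq> 0"
    using assms J_nonzero act_in_H by auto
  have d: "of_real (B$1$1) * of_real (B$2$2) - of_real (B$1$2) * of_real (B$2$1) = (1::complex)"
    using assms(2) by (simp add: det_2 flip: of_real_mult of_real_diff)
  \<comment> \<open>The determinant of \<open>B\<close> enters only through this identity.\<close>
  have id: "e + (e * (a * t + b) + f * (c * t + d)) * c = (e * a + f * c) * (c * t + d)"
    if "a * d - b * c = 1" for a b c d e f t :: complex
  proof -
    have "e + (e * (a * t + b) + f * (c * t + d)) * c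
        = e * (a * d - b * c) + (e * (a * t + b) + f * (c * t + d)) * c" by (simp add: that)
    also have "\<dots> = (e * a + f * c) * (c * t + d)" by (simp add: algebra_simps)
    finally show ?thesis .
  qed
  have a: "act B \<tau> * J B \<tau> = of_real (B$1$1) * \<tau> + of_real (B$1$2)"
    using n(1) by (simp add: act_def moebius_def J_def)
  have "J A (act B \<tau>) * J B \<tau> = of_real (A$2$1) * (of_real (B$1$1) * \<tau> + of_real (B$1$2)) + of_real (A$2$2) * J B \<tau>"
    unfolding a[symmetric] by (simp add: J_def[of A] algebra_simps)
  then have "of_real (A$2$1) + J A (act B \<tau>) * J B \<tau> * of_real (B$2$1) = of_real ((A ** B)$2$1) * J B \<tau>"
    using id[OF d, of "of_real (A$2$1)" \<tau> "of_real (A$2$2)"] unfolding J_def[of B] matrix_mult_2 of_real_add of_real_mult by argo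
  then show ?thesis
    using n by (simp add: X_cocycle_def J_mult assms field_simps power2_eq_square)
qed

lemma has_field_derivative_act:
  assumes "det A = 1" "\<tau> \<in> \<H>"
  shows "(act A has_field_derivative 1 / (J A \<tau>)\<^sup>2) (at \<tau>)"
proof -
  have n: "J A \<tau> \<noteq> 0" using J_nonzero[OF assms] .
  have d: "of_real (A$1$1) * of_real (A$2$2) - of_real (A$1$2) * of_real (A$2$1) = (1::complex)"
    using assms(1) by (simp add: det_2 flip: of_real_mult of_real_diff)
  have "((\<lambda>z. (of_real (A$1$1) * z + of_real (A$1$2)) / (of_real (A$2$1) * z + of_real (A$2$2)))
      has_field_derivative (of_real (A$1$1) * J A \<tau> - (of_real (A$1$1) * \<tau> + of_real (A$1$2)) * of_real (A$2$1)) / (J A \<tau> * J A \<tau>)) (at \<tau>)"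
    using n unfolding J_def by (auto intro!: derivative_eq_intros)
  also have "of_real (A$1$1) * J A \<tau> - (of_real (A$1$1) * \<tau> + of_real (A$1$2)) * of_real (A$2$1) = 1"
    using d by (simp add: J_def algebra_simps)
  finally show ?thesis
    by (simp add: act_def moebius_def power2_eq_square)
qed

lemma measurable_act [measurable]: "act A \<in> borel_measurable borel"
  unfolding act_def moebius_def by measurable

lemma measurable_J [measurable]: "J A \<in> borel_measurable borel"
  unfolding J_def by measurable

lemma open_H: "open \<H>"
  unfolding upper_half_plane_def by (rule open_halfspace_Im_gt)

lemma convex_H: "convex \<H>"
  unfolding upper_half_plane_def by (rule convex_halfspace_Im_gt)

lemma H_borel [measurable]: "\<H> \<in> sets borel"
  using open_H by simp

lemma matrix_inverse_SL2:
  fixes A :: "real^2^2"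
  assumes "det A = 1"
  obtains B where "det B = 1" "A ** B = mat 1" "B ** A = mat 1"
proof -
  have "invertible A" using assms by (simp add: invertible_det_nz)
  then obtain B where B: "A ** B = mat 1" "B ** A = mat 1" unfolding invertible_def by blast
  moreover have "det B = 1" using det_mul[of A B] B assms by (simp add: det_I)
  ultimately show ?thesis using that by blast
qed

lemma bij_betw_act: assumes "det A = 1" shows "bij_betw (act A) \<H> \<H>"
proof -
  obtain B where B: "det B = 1" "A ** B = mat 1" "B ** A = mat 1"
    using matrix_inverse_SL2[OF assms] .
  show ?thesis
    by (rule bij_betw_byWitness[where f' = "act B"])
       (use B assms act_mult[of A B] act_mult[of B A] act_in_H in auto)
qed

section \<open>Hyperbolic area\<close>

definition hyp_measure :: "complex measure"
  where "hyp_measure = density lborel (\<lambda>z. ennreal (indicator \<H> z / (Im z)\<^sup>2))"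

lemma sets_hyp_measure [measurable_cong, simp]: "sets hyp_measure = sets borel"
  and space_hyp_measure [simp]: "space hyp_measure = UNIV"
  by (simp_all add: hyp_measure_def)

lemma integral_hyp_measure:
  fixes g :: "complex \<Rightarrow> real"
  assumes [measurable]: "g \<in> borel_measurable borel"
  shows "(\<integral>z. g z \<partial>hyp_measure) = (\<integral>z. indicator \<H> z * (g z / (Im z)\<^sup>2) \<partial>lborel)"
  unfolding hyp_measure_def by (subst integral_density) (auto simp: mult_ac)

text \<open>The derivative of \<open>act A\<close> is \<open>1 / (J A)\<^sup>2\<close>, so area is multiplied by \<open>norm (J A) powr -4\<close>, and the
density \<open>1 / (Im z)\<^sup>2\<close> is multiplied by the inverse of this factor.\<close>

lemma integral_hyp_measure_act:
  fixes g :: "complex \<Rightarrow> real"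
  assumes [measurable]: "g \<in> borel_measurable borel" and A: "det A = 1"
  shows "(\<integral>z. g (act A z) \<partial>hyp_measure) = (\<integral>z. g z \<partial>hyp_measure)"
proof -
  have im: "act A ` \<H> = \<H>" and inj: "inj_on (act A) \<H>"
    using bij_betw_act[OF A] by (auto simp: bij_betw_def)
  have "(\<integral>z. g z \<partial>hyp_measure) = (\<integral>z. indicator (act A ` \<H>) z * (g z / (Im z)\<^sup>2) \<partial>lborel)"
    by (simp add: integral_hyp_measure im)
  also have "\<dots> = (\<integral>z. indicator \<H> z * ((norm (1 / (J A z)\<^sup>2))\<^sup>2 * (g (act A z) / (Im (act A z))\<^sup>2)) \<partial>lborel)"
    by (rule integral_holomorphic_substitution)
       (use has_field_derivative_act[OF A] inj im in auto)
  also have "\<dots> = (\<integral>z. indicator \<H> z * (g (act A z) / (Im z)\<^sup>2) \<partial>lborel)"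
    by (rule Bochner_Integration.integral_cong)
       (use J_nonzero[OF A] in \<open>auto simp: indicator_def Im_act[OF A] norm_divide norm_power field_simps\<close>)
  also have "\<dots> = (\<integral>z. g (act A z) \<partial>hyp_measure)"
    by (simp add: integral_hyp_measure)
  finally show ?thesis by simp
qed

text \<open>The Cayley map from the unit disc onto \<open>\<H>\<close> that sends the centre to \<open>p\<close>.\<close>

definition disc_chart :: "complex \<Rightarrow> complex \<Rightarrow> complex"
  where "disc_chart p z = (p - cnj p * z) / (1 - z)"

lemma disc_chart_0 [simp]: "disc_chart p 0 = p"
  by (simp add: disc_chart_def)

lemma measurable_disc_chart [measurable]: "disc_chart p \<in> borel_measurable borel"
  unfolding disc_chart_def by measurable

lemma Im_disc_chart:
  assumes "norm z < 1"
  shows "Im (disc_chart p z) = Im p * (1 - (norm z)\<^sup>2) / (norm (1 - z))\<^sup>2"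
  by (simp add: disc_chart_def Im_divide cmod_power2) (simp add: power2_eq_square algebra_simps)

lemma has_field_derivative_disc_chart:
  assumes "norm z < 1"
  shows "(disc_chart p has_field_derivative (p - cnj p) / (1 - z)\<^sup>2) (at z)"
proof -
  have "1 - z \<noteq> 0" using assms by auto
  then show ?thesis
    unfolding disc_chart_def
    by (auto intro!: derivative_eq_intros simp: power2_eq_square) (simp add: algebra_simps)
qed

lemma norm_disc_chart:
  assumes "norm z < 1"
  shows "norm (disc_chart p z - p) = norm z * norm (disc_chart p z - cnj p)"
proof -
  have "1 - z \<noteq> 0" using assms by auto
  then have "disc_chart p z - p = z * (disc_chart p z - cnj p)"
    by (simp add: disc_chart_def field_simps)
  then show ?thesis by (simp add: norm_mult)
qed

lemma norm_diff_less_cnj: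
  assumes "w \<in> \<H>" "p \<in> \<H>"
  shows "norm (w - p) < norm (w - cnj p)"
proof -
  have "(norm (w - p))\<^sup>2 < (norm (w - cnj p))\<^sup>2"
    using assms mult_pos_pos[of "Im w" "Im p"]
    by (simp add: cmod_power2 upper_half_plane_def) (simp add: power2_eq_square algebra_simps)
  then show ?thesis by (rule power2_less_imp_less) simp
qed

lemma bij_betw_disc_chart:
  assumes p: "p \<in> \<H>"
  shows "bij_betw (disc_chart p) (ball 0 1) \<H>"
proof -
  have nz: "w - cnj p \<noteq> 0" if "w \<in> \<H>" for w
    using that p by (auto simp: upper_half_plane_def complex_eq_iff)
  have 1: "(disc_chart p z - p) / (disc_chart p z - cnj p) = z" if "z \<in> ball 0 1" for z
  proof -
    have "1 - z \<noteq> 0" using that by auto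
    moreover have "p - cnj p \<noteq> 0" using nz[OF p] .
    moreover have "disc_chart p z - p = z * (p - cnj p) / (1 - z)" "disc_chart p z - cnj p = (p - cnj p) / (1 - z)"
      using \<open>1 - z \<noteq> 0\<close> by (simp_all add: disc_chart_def field_simps)
    ultimately show ?thesis by simp
  qed
  have 2: "disc_chart p ((w - p) / (w - cnj p)) = w" if "w \<in> \<H>" for w
  proof -
    have "p - cnj p \<noteq> 0" "w - cnj p \<noteq> 0" using nz[OF p] nz[OF that] by auto
    then show ?thesis by (simp add: disc_chart_def divide_simps) (simp add: algebra_simps)
  qed
  have 3: "disc_chart p z \<in> \<H>" if "z \<in> ball 0 1" for z
  proof -
    have "1 - z \<noteq> 0" "(norm z)\<^sup>2 < 1" using that by (auto simp: abs_square_less_1)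
    then show ?thesis
      using that p by (simp add: upper_half_plane_def Im_disc_chart)
  qed
  have 4: "(w - p) / (w - cnj p) \<in> ball 0 1" if "w \<in> \<H>" for w
    using norm_diff_less_cnj[OF that p] by (simp add: norm_divide divide_simps)
  show ?thesis
    by (rule bij_betw_byWitness[where f' = "\<lambda>w. (w - p) / (w - cnj p)"]) (use 1 2 3 4 in auto)
qed

text \<open>In the disc the hyperbolic density is radial.  This is what brings the mean value property to bear on
discs about an arbitrary centre \<open>p\<close>.\<close>

lemma integral_hyp_measure_disc_chart:
  fixes g :: "complex \<Rightarrow> real"
  assumes [measurable]: "g \<in> borel_measurable borel" and p: "p \<in> \<H>"
  shows "(\<integral>w. g w \<partial>hyp_measure)
       = (\<integral>z. indicator (ball 0 1) z * (4 / (1 - (norm z)\<^sup>2)\<^sup>2 * g (disc_chart p z)) \<partial>lborel)"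
proof -
  have im: "disc_chart p ` ball 0 1 = \<H>" and inj: "inj_on (disc_chart p) (ball 0 1)"
    using bij_betw_disc_chart[OF p] by (auto simp: bij_betw_def)
  have "(\<integral>z. g z \<partial>hyp_measure) = (\<integral>z. indicator (disc_chart p ` ball 0 1) z * (g z / (Im z)\<^sup>2) \<partial>lborel)"
    by (simp add: integral_hyp_measure im)
  also have "\<dots> = (\<integral>z. indicator (ball 0 1) z * ((norm ((p - cnj p) / (1 - z)\<^sup>2))\<^sup>2 * (g (disc_chart p z) / (Im (disc_chart p z))\<^sup>2)) \<partial>lborel)"
    by (rule integral_holomorphic_substitution)
       (use has_field_derivative_disc_chart inj im in auto)
  also have "\<dots> = (\<integral>z. indicator (ball 0 1) z * (4 / (1 - (norm z)\<^sup>2)\<^sup>2 * g (disc_chart p z)) \<partial>lborel)"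
  proof (rule Bochner_Integration.integral_cong)
    fix z :: complex
    show "indicator (ball 0 1) z * ((norm ((p - cnj p) / (1 - z)\<^sup>2))\<^sup>2 * (g (disc_chart p z) / (Im (disc_chart p z))\<^sup>2))
       = indicator (ball 0 1) z * (4 / (1 - (norm z)\<^sup>2)\<^sup>2 * g (disc_chart p z))"
    proof (cases "z \<in> ball 0 1")
      case True
      then have z: "norm z < 1" "norm (1 - z) \<noteq> 0" "1 - (norm z)\<^sup>2 \<noteq> 0" 
        by (auto simp: abs_square_eq_1)
      have b: "Im p \<noteq> 0" using p by (simp add: upper_half_plane_def)
      have "p - cnj p = of_real (2 * Im p) * \<i>" by (simp add: complex_eq_iff)
      then have "norm (p - cnj p) = 2 * \<bar>Im p\<bar>" by (simp add: norm_mult)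
      then show ?thesis
        using z b by (simp add: Im_disc_chart norm_divide norm_power)
          (simp add: divide_simps; simp add: power2_eq_square algebra_simps)
    qed simp
  qed simp
  finally show ?thesis .
qed

section \<open>The mean value property\<close>

text \<open>Gauss' mean value property, from Cauchy's formula for \<open>u \<mapsto> H (u * z)\<close> on the unit circle.\<close>

lemma integral_cis_mean:
  assumes H: "H holomorphic_on ball 0 1" and z: "norm z < 1"
  shows "(\<integral>t. indicator {0..1::real} t * Re (H (cis (2 * pi * t) * z)) \<partial>lborel) = Re (H 0)"
proof -
  define h where "h = (\<lambda>u. H (u * z))"
  have hol: "h holomorphic_on cball 0 1"
    unfolding h_def
  proof (rule holomorphic_on_compose_gen[OF _ H, of "\<lambda>u. u * z", unfolded o_def])
    show "(\<lambda>u. u * z) ` cball 0 1 \<subseteq> ball 0 1"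
      using z by (auto simp: norm_mult) (metis mult_left_le_one_le norm_ge_zero order_le_less_trans)
  qed (auto intro!: holomorphic_intros)
  have "((\<lambda>u. h u / (u - 0)) has_contour_integral (2 * of_real pi * \<i> * h 0)) (circlepath 0 1)"
    by (rule Cauchy_integral_circlepath_simple[OF hol]) auto
  then have "((\<lambda>t. h (cis (2 * pi * t)) * (2 * of_real pi * \<i>)) has_integral (2 * of_real pi * \<i> * h 0)) {0..1}"
    unfolding has_contour_integral_def
    by (rule has_integral_eq[rotated])
       (simp add: vector_derivative_circlepath01, simp add: circlepath cis_conv_exp mult_ac)
  from has_integral_mult_left[OF this, of "1 / (2 * of_real pi * \<i>)"]
  have "((\<lambda>t. h (cis (2 * pi * t))) has_integral h 0) {0..1}"
    by (simp add: field_simps)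
  from has_integral_Re[OF this]
  have I: "((\<lambda>t. Re (h (cis (2 * pi * t)))) has_integral Re (H 0)) {0..1}"
    by (simp add: h_def)
  have "continuous_on {0..1} (\<lambda>t. Re (h (cis (2 * pi * t))))"
    by (intro continuous_intros continuous_on_compose2[OF holomorphic_on_imp_continuous_on[OF hol]]) auto
  then have "set_integrable lborel {0..1} (\<lambda>t. Re (h (cis (2 * pi * t))))"
    by (rule borel_integrable_atLeastAtMost'[folded set_integrable_def])
  from set_borel_integral_eq_integral(2)[OF this] integral_unique[OF I]
  show ?thesis
    by (simp add: set_lebesgue_integral_def h_def)
qed

lemma integral_lborel_rotate:
  fixes g :: "complex \<Rightarrow> real"
  assumes [measurable]: "g \<in> borel_measurable borel"
  shows "(\<integral>z. g (cis t * z) \<partial>lborel) = (\<integral>z. g z \<partial>lborel)"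
proof -
  have im: "(\<lambda>z. cis t * z) ` UNIV = UNIV"
    by (rule surjI[of _ "\<lambda>z. cis (-t) * z"]) (simp add: mult.assoc[symmetric] cis_mult)
  have "(\<integral>z. g z \<partial>lborel) = (\<integral>z. indicator ((\<lambda>z. cis t * z) ` UNIV) z * g z \<partial>lborel)"
    by (simp only: im) simp
  also have "\<dots> = (\<integral>z. indicator UNIV z * ((norm (cis t))\<^sup>2 * g (cis t * z)) \<partial>lborel)"
    by (rule integral_holomorphic_substitution[where f' = "\<lambda>_. cis t"])
       (auto simp: im inj_on_def intro!: derivative_eq_intros)
  finally show ?thesis by simp
qed

text \<open>Lebesgue measure and the weight are invariant under rotations, so the integrand may be averaged over
all rotations; Gauss' mean value property evaluates this average.  Fubini's theorem exchanges the two
integrations.\<close>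

lemma integral_radial_mean_value:
  fixes W :: "real \<Rightarrow> real"
  assumes H: "H holomorphic_on ball 0 1" and r: "0 < r" "r < 1"
    and W: "continuous_on {0..r} W" and [measurable]: "W \<in> borel_measurable borel"
  shows "integrable lborel (\<lambda>z. indicator (ball 0 r) z * (W (norm z) * Re (H z)))"
    and "(\<integral>z. indicator (ball 0 r) z * (W (norm z) * Re (H z)) \<partial>lborel)
       = Re (H 0) * (\<integral>z. indicator (ball 0 r) z * W (norm (z::complex)) \<partial>lborel)"
proof -
  define K where "K = (\<lambda>z. indicator (ball 0 r) z * (W (norm z) * Re (H z)))"
  have contH: "continuous_on (cball 0 r) H"
    using r by (intro holomorphic_on_imp_continuous_on holomorphic_on_subset[OF H]) auto
  have "continuous_on (cball 0 r) (\<lambda>z::complex. W (norm z))"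
    by (rule continuous_on_compose2[OF W]) (auto intro!: continuous_intros)
  then have "continuous_on (cball 0 r) (\<lambda>z. W (norm z) * Re (H z))"
    by (intro continuous_intros contH)
  then have "compact ((\<lambda>z. W (norm z) * Re (H z)) ` cball 0 r)"
    by (rule compact_continuous_image) simp
  then have "bounded ((\<lambda>z. W (norm z) * Re (H z)) ` cball 0 r)"
    by (rule compact_imp_bounded)
  then obtain C where "\<And>z. z \<in> cball 0 r \<Longrightarrow> norm (W (norm z) * Re (H z)) \<le> C"
    unfolding bounded_iff by blast
  then have bound: "norm (K z) \<le> C" if "z \<in> ball 0 r" for z
    using that by (auto simp: K_def)
  define H0 where "H0 = (\<lambda>z. if z \<in> ball 0 r then H z else 0)"
  have [measurable]: "H0 \<in> borel_measurable borel"
    using r unfolding H0_def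
    by (intro borel_measurable_continuous_on_if continuous_on_subset[OF contH]) auto
  have [measurable]: "ball (0::complex) r \<in> sets borel" by simp
  have Keq: "K = (\<lambda>z. indicator (ball 0 r) z * (W (norm z) * Re (H0 z)))"
    by (auto simp: K_def H0_def indicator_def fun_eq_iff)
  have Km[measurable]: "K \<in> borel_measurable borel"
    unfolding Keq by measurable
  have ball_finite: "emeasure lborel (ball (0::complex) r) < \<infinity>"
    by (rule emeasure_lborel_ball_finite)
  have Kint: "integrable lborel K"
  proof (rule integrableI_bounded_set[of "ball 0 r" _ _ C])
    show "AE x in lborel. x \<in> ball 0 r \<longrightarrow> norm (K x) \<le> C"
      using bound by simp
    show "K \<in> borel_measurable lborel" using Km by simp
  qed (use ball_finite in \<open>auto simp: K_def\<close>)
  then show "integrable lborel (\<lambda>z. indicator (ball 0 r) z * (W (norm z) * Re (H z)))"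
    by (simp add: K_def)
  define L where "L = (\<lambda>(t, z). indicator {0..1::real} t * K (cis (2 * pi * t) * z))"
  have [measurable]: "cis \<in> borel_measurable borel"
    by (intro borel_measurable_continuous_onI continuous_intros)
  have Lm[measurable]: "L \<in> borel_measurable (lborel \<Otimes>\<^sub>M lborel)"
    unfolding L_def by measurable
  have Lint: "integrable (lborel \<Otimes>\<^sub>M lborel) L"
  proof (rule integrableI_bounded_set[of "{0..1} \<times> ball 0 r" _ _ C])
    have "emeasure (lborel \<Otimes>\<^sub>M lborel) ({0..1::real} \<times> ball (0::complex) r) 
        = emeasure lborel {0..1::real} * emeasure lborel (ball (0::complex) r)"
      by (rule lborel.emeasure_pair_measure_Times) auto
    also have "\<dots> < \<infinity>"
      using ball_finite by (simp add: ennreal_mult_less_top)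
    finally show "emeasure (lborel \<Otimes>\<^sub>M lborel) ({0..1::real} \<times> ball (0::complex) r) < \<infinity>" .
    show "AE x in lborel \<Otimes>\<^sub>M lborel. x \<in> {0..1} \<times> ball 0 r \<longrightarrow> norm (L x) \<le> C"
      using bound by (intro AE_I2) (auto simp: L_def norm_mult)
    show "AE x in lborel \<Otimes>\<^sub>M lborel. x \<notin> {0..1} \<times> ball 0 r \<longrightarrow> L x = 0"
      by (intro AE_I2) (auto simp: L_def K_def norm_mult indicator_def)
    show "L \<in> borel_measurable (lborel \<Otimes>\<^sub>M lborel)" by (rule Lm)
    show "{0..1::real} \<times> ball (0::complex) r \<in> sets (lborel \<Otimes>\<^sub>M lborel)" by auto
  qed
  have "(\<integral>z. K z \<partial>lborel) = (\<integral>t. indicator {0..1::real} t * (\<integral>z. K z \<partial>lborel) \<partial>lborel)"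
    by simp
  also have "\<dots> = (\<integral>t. (\<integral>z. L (t, z) \<partial>lborel) \<partial>lborel)"
    by (rule Bochner_Integration.integral_cong) (simp_all add: L_def integral_lborel_rotate)
  also have "\<dots> = (\<integral>z. (\<integral>t. L (t, z) \<partial>lborel) \<partial>lborel)"
    by (rule lborel_pair.Fubini_integral[symmetric]) (simp add: Lint)
  also have "\<dots> = (\<integral>z. Re (H 0) * (indicator (ball 0 r) z * W (norm (z::complex))) \<partial>lborel)"
  proof (rule Bochner_Integration.integral_cong[OF refl])
    fix z :: complex
    have "(\<integral>t. L (t, z) \<partial>lborel) = (\<integral>t. (indicator (ball 0 r) z * W (norm z)) *
        (indicator {0..1::real} t * Re (H (cis (2 * pi * t) * z))) \<partial>lborel)"
      by (rule Bochner_Integration.integral_cong) (auto simp: L_def K_def norm_mult indicator_def)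
    also have "\<dots> = (indicator (ball 0 r) z * W (norm z)) * (\<integral>t. 
        (indicator {0..1::real} t * Re (H (cis (2 * pi * t) * z))) \<partial>lborel)"
      by simp
    also have "\<dots> = Re (H 0) * (indicator (ball 0 r) z * W (norm z))"
      using integral_cis_mean[OF H, of z] r by (cases "z \<in> ball 0 r") auto
    finally show "(\<integral>t. L (t, z) \<partial>lborel) = Re (H 0) * (indicator (ball 0 r) z * W (norm z))" .
  qed
  finally show "(\<integral>z. indicator (ball 0 r) z * (W (norm z) * Re (H z)) \<partial>lborel)
       = Re (H 0) * (\<integral>z. indicator (ball 0 r) z * W (norm (z::complex)) \<partial>lborel)"
    by (simp add: K_def)
qed

text \<open>For \<open>p\<close> in \<open>\<H>\<close> the part in \<open>\<H>\<close> is the open hyperbolic disc about \<open>p\<close> that corresponds to the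
Euclidean disc of radius \<open>1/2\<close> in the chart \<open>disc_chart p\<close>.  Any radius below 1 would do.\<close>

definition hyp_disc :: "complex \<Rightarrow> complex set"
  where "hyp_disc p = {w. norm (w - p) < 1 / 2 * norm (w - cnj p)}"

text \<open>The amount by which the strictly superharmonic function \<open>ln (Im w)\<close> violates the mean value property
on such a disc.  It does not depend on the centre.\<close>

definition disc_defect :: real
  where "disc_defect = (\<integral>z. indicator (ball 0 (1/2)) z *
            (4 / (1 - (norm (z::complex))\<^sup>2)\<^sup>2 * ln (1 - (norm z)\<^sup>2)) \<partial>lborel)"

lemma one_minus_square_nonzero: "x \<in> {0..1/2} \<Longrightarrow> 1 - x\<^sup>2 > (0::real)"
  using power_mono[of x "1/2" 2] by (auto simp: power2_eq_square)

lemma weights_continuous: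
  "continuous_on {0..1/2::real} (\<lambda>x. 4 / (1 - x\<^sup>2)\<^sup>2)"
  "continuous_on {0..1/2::real} (\<lambda>x. 4 / (1 - x\<^sup>2)\<^sup>2 * ln (1 - x\<^sup>2))"
  by (intro continuous_intros; use one_minus_square_nonzero in force)+

lemma integrable_disc_defect:
  "integrable lborel (\<lambda>z::complex. indicator (ball 0 (1/2)) z *
            (4 / (1 - (norm z)\<^sup>2)\<^sup>2 * ln (1 - (norm z)\<^sup>2)))"
  using integral_radial_mean_value(1)[of "\<lambda>_. 1", OF _ _ _ weights_continuous(2)] by simp

lemma integral_pos_of_open:
  fixes f :: "complex \<Rightarrow> real"
  assumes int: "integrable lborel f" and nonneg: "\<And>z. 0 \<le> f z"
    and U: "open U" "U \<noteq> {}" and pos: "\<And>z. z \<in> U \<Longrightarrow> 0 < f z"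
  shows "0 < (\<integral>z. f z \<partial>lborel)"
proof -
  obtain c e where ball: "0 < e" "ball c e \<subseteq> U"
    using U openE by (metis ex_in_conv)
  have "(\<integral>z. f z \<partial>lborel) \<noteq> 0"
  proof
    assume "(\<integral>z. f z \<partial>lborel) = 0"
    then have "AE z in lborel. f z = 0"
      using integral_nonneg_eq_0_iff_AE[OF int] nonneg by simp
    then have "AE z in lborel. z \<notin> ball c e"
      by (rule AE_mp) (intro AE_I2 impI notI, use ball pos in fastforce)
    then have "emeasure lborel (ball c e) = 0"
      by (subst (asm) AE_iff_measurable[where N = "ball c e"]) auto
    then show False
      using content_ball_pos[OF ball(1), of c] by (simp add: Sigma_Algebra.measure_def)
  qed
  moreover have "0 \<le> (\<integral>z. f z \<partial>lborel)" using nonneg by simp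
  ultimately show ?thesis by simp
qed

lemma disc_defect_neg: "disc_defect < 0"
proof -
  define f where "f = (\<lambda>z::complex. indicator (ball 0 (1/2)) z *
            (4 / (1 - (norm z)\<^sup>2)\<^sup>2 * ln (1 - (norm z)\<^sup>2)))"
  have f_eq: "f z = 4 / (1 - (norm z)\<^sup>2)\<^sup>2 * ln (1 - (norm z)\<^sup>2)" "0 < 1 - (norm z)\<^sup>2"
    if "norm z < 1/2" for z
    using that one_minus_square_nonzero[of "norm z"] by (simp_all add: f_def)
  have le: "f z \<le> 0" for z
  proof (cases "norm z < 1/2")
    case True
    then have "ln (1 - (norm z)\<^sup>2) \<le> 0" using f_eq(2)[of z] by (subst ln_le_zero_iff) simp_all
    then show ?thesis unfolding f_eq(1)[OF True] by (intro mult_nonneg_nonpos) simp_all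
  qed (simp add: f_def)
  have neg: "f z < 0" if "z \<in> ball (1/4) (1/8)" for z
  proof -
    have "norm (1/4 - z) < 1/8" using that by (simp add: dist_norm)
    moreover have "norm (1/4::complex) = 1/4" by simp
    ultimately have z: "0 < norm z" "norm z < 1/2"
      using norm_triangle_ineq2[of "1/4" z] norm_triangle_ineq2[of z "1/4"] by (auto simp: norm_minus_commute)
    then have "ln (1 - (norm z)\<^sup>2) < 0" using f_eq(2)[of z] by (subst ln_less_zero_iff) simp_all
    then show ?thesis using f_eq(2)[OF z(2)] unfolding f_eq(1)[OF z(2)] by (intro mult_pos_neg) simp_all
  qed
  have "0 < (\<integral>z. - f z \<partial>lborel)"
    by (rule integral_pos_of_open[where U = "ball (1/4) (1/8)"])
       (use integrable_disc_defect le neg in \<open>auto simp: f_def\<close>)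
  then show ?thesis by (simp add: disc_defect_def f_def)
qed

text \<open>In the chart about \<open>p\<close>, the function \<open>2 * Re h + ln Im\<close> minus its value at \<open>p\<close> is the real part of a
holomorphic function that vanishes at 0, plus \<open>ln (1 - (norm z)\<^sup>2)\<close>.  The former averages to zero; the
latter gives the same negative constant for every \<open>p\<close>.\<close>

lemma hyp_disc_average:
  fixes h :: "complex \<Rightarrow> complex"
  assumes hol: "h holomorphic_on \<H>" and [measurable]: "h \<in> borel_measurable borel"
    and p: "p \<in> \<H>"
  shows "(\<integral>w. indicator (hyp_disc p) w *
          ((2 * Re (h w) + ln (Im w)) - (2 * Re (h p) + ln (Im p))) \<partial>hyp_measure) = disc_defect"
proof -
  let ?g = "\<lambda>w. indicator (hyp_disc p) w * ((2 * Re (h w) + ln (Im w)) - (2 * Re (h p) + ln (Im p)))"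
  let ?W = "\<lambda>x::real. 4 / (1 - x\<^sup>2)\<^sup>2"
  define H where "H = (\<lambda>z. 2 * (h (disc_chart p z) - h p - Ln (1 - z)))"
  have [measurable]: "hyp_disc p \<in> sets borel"
    unfolding hyp_disc_def by measurable
  have gm: "?g \<in> borel_measurable borel" by measurable
  have chart: "disc_chart p z \<in> \<H>" if "norm z < 1" for z
    using bij_betw_disc_chart[OF p] that by (auto simp: bij_betw_def)
  have "disc_chart p holomorphic_on ball 0 1"
    using has_field_derivative_disc_chart
    by (intro holomorphic_onI) (auto simp: field_differentiable_def intro: has_field_derivative_at_within)
  then have "(\<lambda>z. h (disc_chart p z)) holomorphic_on ball 0 1"
    by (rule holomorphic_on_compose_gen[OF _ hol, unfolded o_def]) (use chart in auto)
  moreover have "1 - z \<notin> \<real>\<^sub>\<le>\<^sub>0" if "z \<in> ball 0 1" for z :: complex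
    using that complex_Re_le_cmod[of z] by (auto simp: complex_nonpos_Reals_iff)
  ultimately have H: "H holomorphic_on ball 0 1"
    unfolding H_def by (intro holomorphic_intros) auto
  have H0: "H 0 = 0" by (simp add: H_def)
  have "(\<integral>w. ?g w \<partial>hyp_measure)
      = (\<integral>z. indicator (ball 0 1) z * (?W (norm z) * ?g (disc_chart p z)) \<partial>lborel)"
    by (rule integral_hyp_measure_disc_chart[OF gm p])
  also have "\<dots> = (\<integral>z. indicator (ball 0 (1/2)) z * (?W (norm z) * Re (H z)) +
       indicator (ball 0 (1/2)) z * (?W (norm z) * ln (1 - (norm z)\<^sup>2)) \<partial>lborel)"
  proof (rule Bochner_Integration.integral_cong)
    fix z :: complex
    show "indicator (ball 0 1) z * (?W (norm z) * ?g (disc_chart p z)) =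
       indicator (ball 0 (1/2)) z * (?W (norm z) * Re (H z)) +
       indicator (ball 0 (1/2)) z * (?W (norm z) * ln (1 - (norm z)\<^sup>2))"
    proof (cases "norm z < 1")
      case True
      have c: "disc_chart p z - cnj p \<noteq> 0"
        using chart[OF True] p by (auto simp: upper_half_plane_def complex_eq_iff)
      then have ind: "indicator (hyp_disc p) (disc_chart p z) = (indicator (ball 0 (1/2)) z :: real)"
        by (simp add: hyp_disc_def norm_disc_chart[OF True] indicator_def)
      have z: "1 - z \<noteq> 0" "(norm z)\<^sup>2 < 1" using True by (auto simp: abs_square_less_1)
      have "ln (Im (disc_chart p z)) = ln (Im p) + ln (1 - (norm z)\<^sup>2) - 2 * ln (norm (1 - z))"
        using z p by (simp add: Im_disc_chart[OF True] upper_half_plane_def ln_div ln_mult ln_realpow)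
      moreover have "Re (H z) = 2 * Re (h (disc_chart p z)) - 2 * Re (h p) - 2 * ln (norm (1 - z))"
        using z by (simp add: H_def)
      ultimately have X: "(2 * Re (h (disc_chart p z)) + ln (Im (disc_chart p z))) - (2 * Re (h p) + ln (Im p))
          = Re (H z) + ln (1 - (norm z)\<^sup>2)" by linarith
      have "indicator (ball 0 1) z = (1::real)" using True by simp
      then show ?thesis
        unfolding ind X by (simp only: mult_1_left distrib_left mult.left_commute)
    qed (auto simp: indicator_def)
  qed simp
  also have "\<dots> = (\<integral>z. indicator (ball 0 (1/2)) z * (?W (norm z) * Re (H z)) \<partial>lborel) + disc_defect"
    unfolding disc_defect_def
    by (rule Bochner_Integration.integral_add[OF integral_radial_mean_value(1)[OF H _ _ weights_continuous(1)] integrable_disc_defect]) auto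
  also have "(\<integral>z. indicator (ball 0 (1/2)) z * (?W (norm z) * Re (H z)) \<partial>lborel) = 0"
    using integral_radial_mean_value(2)[OF H _ _ weights_continuous(1)] H0 by simp
  finally show ?thesis by simp
qed

section \<open>Truncations of the half plane\<close>

text \<open>These sets exhaust \<open>\<H>\<close> and are relatively compact in it.  For \<open>M \<le> 0\<close> they are empty.\<close>

definition truncation :: "real \<Rightarrow> complex set"
  where "truncation M = {z. norm z < M \<and> 1 / M < Im z}"

lemma truncation_pos: "z \<in> truncation M \<Longrightarrow> 0 < M"
  using norm_ge_zero[of z] unfolding truncation_def by (auto simp del: norm_ge_zero)

lemma truncation_subset_H: "truncation M \<subseteq> \<H>"
proof
  fix z assume z: "z \<in> truncation M"
  have "0 < 1 / M" using truncation_pos[OF z] by simp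
  also have "1 / M < Im z" using z by (simp add: truncation_def)
  finally show "z \<in> \<H>" by (simp add: upper_half_plane_def)
qed

lemma open_truncation: "open (truncation M)"
proof -
  have "truncation M = ball 0 M \<inter> {z. 1 / M < Im z}" by (auto simp: truncation_def)
  then show ?thesis by (simp add: open_Int open_halfspace_Im_gt)
qed

lemma truncation_borel [measurable]: "truncation M \<in> sets borel"
  using open_truncation by simp

lemma truncation_in_compact:
  assumes "M > 0"
  obtains K where "compact K" "truncation M \<subseteq> K" "K \<subseteq> \<H>"
proof
  have "cball 0 M \<inter> {z. 1 / M \<le> Im z} = {z. norm z \<le> M \<and> 1 / M \<le> Im z}" by auto
  moreover have "compact (cball (0::complex) M \<inter> {z. 1 / M \<le> Im z})"
    by (intro compact_Int_closed compact_cball closed_halfspace_Im_ge)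
  ultimately show "compact {z. norm z \<le> M \<and> 1 / M \<le> Im z}" by simp
  show "truncation M \<subseteq> {z. norm z \<le> M \<and> 1 / M \<le> Im z}" by (auto simp: truncation_def)
  show "{z. norm z \<le> M \<and> 1 / M \<le> Im z} \<subseteq> \<H>"
  proof clarify
    fix z :: complex assume "1 / M \<le> Im z"
    moreover have "0 < 1 / M" using assms by simp
    ultimately have "0 < Im z" by (rule less_le_trans[rotated])
    then show "z \<in> \<H>" by (simp add: upper_half_plane_def)
  qed
qed

text \<open>Hyperbolic discs of fixed radius about the points of a relatively compact set stay in a relatively
compact set.  The constant 6 is a crude choice: the point \<open>w\<close> satisfies \<open>norm w < 3 * N\<close> and
\<open>Im w > 3 / (16 * N)\<close>.\<close>

lemma truncation_enlarge:
  assumes p: "p \<in> truncation N" and w: "w \<in> hyp_disc p" "w \<in> \<H>"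
  shows "w \<in> truncation (6 * N)"
proof -
  have N: "0 < N" using truncation_pos[OF p] .
  have pN: "norm p < N" "1 / N < Im p" using p by (auto simp: truncation_def)
  have y: "0 < Im p" "0 < Im w" using p w truncation_subset_H by (auto simp: upper_half_plane_def)
  have d: "norm (w - p) < 1 / 2 * norm (w - cnj p)" using w by (simp add: hyp_disc_def)
  have "w - cnj p = (w - p) + (p - cnj p)" by simp
  then have "norm (w - cnj p) \<le> norm (w - p) + norm (p - cnj p)" by (metis norm_triangle_ineq)
  moreover have "p - cnj p = of_real (2 * Im p) * \<i>" by (simp add: complex_eq_iff)
  then have "norm (p - cnj p) = 2 * Im p" using y by (simp add: norm_mult)
  moreover have "Im p \<le> norm p" using abs_Im_le_cmod[of p] by linarith
  ultimately have "norm (w - p) < 2 * N" using d pN by linarith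
  then have 1: "norm w < 6 * N" using pN norm_triangle_ineq2[of w p] N by linarith
  \<comment> \<open>If \<open>Im w\<close> were small compared with \<open>Im p\<close>, the distances of \<open>w\<close> from \<open>p\<close> and from its
    reflection would be almost equal.\<close>
  have sq: "(norm (w - cnj p))\<^sup>2 = (norm (w - p))\<^sup>2 + 4 * (Im w * Im p)"
    by (simp add: cmod_power2) (simp add: power2_eq_square algebra_simps)
  have "(norm (w - p))\<^sup>2 \<le> (1 / 2 * norm (w - cnj p))\<^sup>2"
    using d by (intro power_mono) auto
  moreover have quarter: "(1 / 2 * norm (w - cnj p))\<^sup>2 = 1 / 4 * (norm (w - cnj p))\<^sup>2"
    unfolding power_mult_distrib by (simp add: power_divide)
  ultimately have "3 / 4 * (norm (w - cnj p))\<^sup>2 \<le> 4 * (Im w * Im p)"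
    using sq quarter by linarith
  moreover have "Im p \<le> norm (w - cnj p)"
    using abs_Im_le_cmod[of "w - cnj p"] y by simp
  then have "Im p * Im p \<le> (norm (w - cnj p))\<^sup>2"
    unfolding power2_eq_square using y by (intro mult_mono) auto
  ultimately have "Im p * Im p \<le> (16 / 3 * Im w) * Im p" by linarith
  then have "Im p \<le> 16 / 3 * Im w" using y by (simp only: mult_le_cancel_right_pos)
  moreover have "1 / (6 * N) = (1 / 6) * (1 / N)" by simp
  ultimately have "1 / (6 * N) < Im w" using pN y by linarith
  with 1 show ?thesis by (simp add: truncation_def)
qed

interpretation hyp: sigma_finite_measure hyp_measure
proof -
  have "(\<lambda>z. ennreal (indicator \<H> z / (Im z)\<^sup>2)) \<in> borel_measurable lborel" by measurable
  then show "sigma_finite_measure hyp_measure"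
    unfolding hyp_measure_def
  proof (rule iffD2[OF sigma_finite_measure.sigma_finite_iff_density_finite[OF lborel.sigma_finite_measure_axioms]], intro AE_I2)
    fix z :: complex
    show "ennreal (indicator \<H> z / (Im z)\<^sup>2) \<noteq> \<infinity>" by (rule ennreal_neq_top[folded infinity_ennreal_def])
  qed
qed

interpretation hyp_pair: pair_sigma_finite hyp_measure hyp_measure ..

lemma emeasure_truncation_finite: "emeasure hyp_measure (truncation M) < \<infinity>"
proof -
  have "emeasure hyp_measure (truncation M)
      = (\<integral>\<^sup>+z. ennreal (indicator \<H> z / (Im z)\<^sup>2) * indicator (truncation M) z \<partial>lborel)"
    unfolding hyp_measure_def by (rule emeasure_density) auto
  also have "\<dots> \<le> (\<integral>\<^sup>+z. ennreal (M\<^sup>2) * indicator (ball (0::complex) M) z \<partial>lborel)"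
  proof (rule nn_integral_mono)
    fix z :: complex
    show "ennreal (indicator \<H> z / (Im z)\<^sup>2) * indicator (truncation M) z \<le> ennreal (M\<^sup>2) * indicator (ball 0 M) z"
    proof (cases "z \<in> truncation M")
      case True
      then have "0 < M" by (rule truncation_pos)
      moreover have z: "z \<in> \<H>" "norm z < M" "1 / M < Im z" using True truncation_subset_H by (auto simp: truncation_def)
      ultimately have "1 < M * Im z" by (simp add: field_simps)
      then have "1 \<le> (M * Im z)\<^sup>2" by (simp add: one_le_power)
      then have "1 / (Im z)\<^sup>2 \<le> M\<^sup>2"
        using z by (simp add: upper_half_plane_def divide_le_eq power_mult_distrib)
      then show ?thesis using z True by (simp add: ennreal_leI)
    qed simp
  qed
  also have "\<dots> = ennreal (M\<^sup>2) * emeasure lborel (ball (0::complex) M)"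
    by (simp add: nn_integral_cmult_indicator)
  also have "\<dots> < \<infinity>"
    using emeasure_lborel_ball_finite[of "0::complex" M] by (simp add: ennreal_mult_less_top)
  finally show ?thesis .
qed

lemma AE_hyp_measure_H: "AE z in hyp_measure. z \<in> \<H>"
  unfolding hyp_measure_def by (subst AE_density) (auto simp: indicator_def)

lemma measurable_cnj [measurable]: "cnj \<in> borel_measurable borel"
  by (intro borel_measurable_continuous_onI continuous_intros)

lemma act_diff:
  assumes "det A = 1" "J A w \<noteq> 0" "J A p \<noteq> 0"
  shows "act A w - act A p = (w - p) / (J A w * J A p)"
proof -
  have d: "of_real (A$1$1) * of_real (A$2$2) - of_real (A$1$2) * of_real (A$2$1) = (1::complex)"
    using assms(1) by (simp add: det_2 flip: of_real_mult of_real_diff)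
  have *: "act A \<tau> = (of_real (A$1$1) * \<tau> + of_real (A$1$2)) / J A \<tau>" for \<tau>
    by (simp add: act_def moebius_def J_def)
  have "(of_real (A$1$1) * w + of_real (A$1$2)) * J A p - (of_real (A$1$1) * p + of_real (A$1$2)) * J A w
      = (of_real (A$1$1) * of_real (A$2$2) - of_real (A$1$2) * of_real (A$2$1)) * (w - p)"
    by (simp add: J_def algebra_simps)
  then show ?thesis using assms by (simp add: * d diff_frac_eq)
qed

text \<open>The quotient \<open>norm (w - p) / norm (w - cnj p)\<close> is a function of the hyperbolic distance.\<close>

lemma hyp_disc_act_iff:
  assumes A: "det A = 1" and "p \<in> \<H>" "w \<in> \<H>"
  shows "act A w \<in> hyp_disc (act A p) \<longleftrightarrow> w \<in> hyp_disc p"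
proof -
  have n: "J A w \<noteq> 0" "J A p \<noteq> 0" using J_nonzero assms by auto
  have c: "J A (cnj p) = cnj (J A p)" "act A (cnj p) = cnj (act A p)"
    by (simp_all add: J_def act_def moebius_def)
  have "act A w - act A p = (w - p) / (J A w * J A p)" using act_diff[OF A n] .
  moreover have "act A w - cnj (act A p) = (w - cnj p) / (J A w * cnj (J A p))"
    using act_diff[of A w "cnj p"] A n by (simp add: c)
  moreover have scale: "a / s < 1 / 2 * (b / s) \<longleftrightarrow> a < 1 / 2 * b" if "0 < s" for a b s :: real
    using that by (simp add: field_simps)
  ultimately have "norm (act A w - act A p) = norm (w - p) / (norm (J A w) * norm (J A p))"
    "norm (act A w - cnj (act A p)) = norm (w - cnj p) / (norm (J A w) * norm (J A p))"
    by (simp_all add: norm_divide norm_mult)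
  moreover have "0 < norm (J A w) * norm (J A p)" using n by simp
  ultimately show ?thesis
    unfolding hyp_disc_def mem_Collect_eq by (simp only: scale)
qed

lemma hyp_disc_sym: "w \<in> hyp_disc p \<longleftrightarrow> p \<in> hyp_disc w"
proof -
  have "norm (w - cnj p) = norm (cnj (w - cnj p))" by (simp only: complex_mod_cnj)
  then show ?thesis by (simp add: hyp_disc_def norm_minus_commute)
qed

section \<open>Unfolding over a cocompact lattice\<close>

text \<open>What the argument uses of a cocompact Fuchsian group, formulated for the group of its lifts to
\<open>SL\<^sub>2(\<real>)\<close>: the action is properly discontinuous, and the translates of some relatively compact set
cover \<open>\<H>\<close>.\<close>

locale cocompact_lattice =
  fixes G :: "(real^2^2) set" and N :: real
  assumes det_G: "A \<in> G \<Longrightarrow> det A = 1"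
    and one_G: "mat 1 \<in> G"
    and mult_G: "A \<in> G \<Longrightarrow> B \<in> G \<Longrightarrow> A ** B \<in> G"
    and inv_G: "A \<in> G \<Longrightarrow> matrix_inv A \<in> G"
    and finite_G: "finite {A \<in> G. \<exists>w\<in>truncation M. act A w \<in> truncation M}"
    and cover: "\<tau> \<in> \<H> \<Longrightarrow> \<exists>A\<in>G. act A \<tau> \<in> truncation N"
begin

lemma N_pos: "0 < N"
proof -
  have "\<i> \<in> \<H>" by (simp add: upper_half_plane_def)
  then obtain A where "act A \<i> \<in> truncation N" using cover by blast
  then show ?thesis by (rule truncation_pos)
qed

lemma inverse_G:
  assumes "A \<in> G"
  shows "A ** matrix_inv A = mat 1" "matrix_inv A ** A = mat 1" "matrix_inv (matrix_inv A) = A"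
proof -
  have inv: "B ** matrix_inv B = mat 1 \<and> matrix_inv B ** B = mat 1" if "B \<in> G" for B
    unfolding matrix_inv_def
    by (rule someI_ex) (use matrix_inverse_SL2[OF det_G[OF that]] in metis)
  show 1: "A ** matrix_inv A = mat 1" "matrix_inv A ** A = mat 1"
    using inv[OF assms] by auto
  have "matrix_inv (matrix_inv A) = (A ** matrix_inv A) ** matrix_inv (matrix_inv A)"
    by (simp add: 1)
  also have "\<dots> = A ** (matrix_inv A ** matrix_inv (matrix_inv A))"
    by (simp only: matrix_mul_assoc)
  also have "\<dots> = A" using inv[OF inv_G[OF assms]] by simp
  finally show "matrix_inv (matrix_inv A) = A" .
qed

lemma act_inverse:
  assumes "A \<in> G" "\<tau> \<in> \<H>"
  shows "act A (act (matrix_inv A) \<tau>) = \<tau>" "act (matrix_inv A) (act A \<tau>) = \<tau>"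
  using act_mult[of A "matrix_inv A" \<tau>] act_mult[of "matrix_inv A" A \<tau>] inverse_G[OF assms(1)] assms
    det_G inv_G by auto

text \<open>The elements that move \<open>w\<close> into the covering set; their number is invariant and positive.\<close>

definition visits :: "complex \<Rightarrow> (real^2^2) set"
  where "visits w = {A \<in> G. act A w \<in> truncation N}"

lemma card_visits_act:
  assumes "B \<in> G" "w \<in> \<H>"
  shows "card (visits (act B w)) = card (visits w)"
proof (rule bij_betw_same_card)
  show "bij_betw (\<lambda>A. A ** B) (visits (act B w)) (visits w)"
  proof (rule bij_betw_byWitness[where f' = "\<lambda>A. A ** matrix_inv B"])
    show "(\<lambda>A. A ** B) ` visits (act B w) \<subseteq> visits w"
      using assms by (auto simp: visits_def mult_G act_mult det_G)
    show "(\<lambda>A. A ** matrix_inv B) ` visits w \<subseteq> visits (act B w)"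
      using assms act_in_H[OF det_G[OF assms(1)]]
      by (auto simp: visits_def mult_G inv_G act_mult det_G act_inverse)
    show "\<forall>A\<in>visits (act B w). A ** B ** matrix_inv B = A" "\<forall>A\<in>visits w. A ** matrix_inv B ** B = A"
      using inverse_G[OF assms(1)] by (metis matrix_mul_assoc matrix_mul_rid)+
  qed
qed

text \<open>A finite set, closed under inversion, that contains every element relevant to the sums below.\<close>

definition near :: "(real^2^2) set"
  where "near = {A \<in> G. \<exists>w\<in>truncation (6 * N). act A w \<in> truncation (6 * N)}"

lemma finite_near: "finite near"
  unfolding near_def by (rule finite_G)

lemma truncation_N_subset: "truncation N \<subseteq> truncation (6 * N)"
proof -
  have "1 / (6 * N) \<le> 1 / N" using N_pos by (intro divide_left_mono) auto
  then show ?thesis using N_pos unfolding truncation_def by auto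
qed

lemma visits_subset_near: "w \<in> truncation (6 * N) \<Longrightarrow> visits w \<subseteq> near"
  using truncation_N_subset by (auto simp: visits_def near_def)

text \<open>A function with relatively compact support whose translates under the group sum to 1.  The
denominator is the number of visits; it is written as a sum over the fixed finite set \<open>near\<close>, which
agrees with this number on the support and makes measurability evident.\<close>

definition weight :: "complex \<Rightarrow> real"
  where "weight w = indicator (truncation N) w / (\<Sum>A\<in>near. indicator (truncation N) (act A w))"

lemma measurable_weight [measurable]: "weight \<in> borel_measurable borel"
  unfolding weight_def by measurable

lemma sum_near_eq_card:
  assumes "w \<in> truncation (6 * N)"
  shows "(\<Sum>A\<in>near. indicator (truncation N) (act A w)) = real (card (visits w))"
proof -
  have "near \<inter> {A. act A w \<in> truncation N} = visits w"
    using visits_subset_near[OF assms] by (auto simp: visits_def near_def)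
  then show ?thesis
    using finite_near by (simp add: indicator_def sum.If_cases flip: Int_def)
qed

lemma card_visits_pos:
  assumes "w \<in> truncation (6 * N)" shows "card (visits w) > 0"
proof -
  have "visits w \<noteq> {}"
    using cover[of w] assms truncation_subset_H by (auto simp: visits_def)
  then show ?thesis
    using finite_subset[OF visits_subset_near[OF assms] finite_near] by (simp add: card_gt_0_iff)
qed

lemma weight_eq: "w \<in> truncation N \<Longrightarrow> weight w = 1 / real (card (visits w))"
  using sum_near_eq_card[of w] truncation_N_subset by (auto simp: weight_def)

lemma weight_bounds: "0 \<le> weight w" "weight w \<le> 1"
proof -
  show "weight w \<le> 1"
  proof (cases "w \<in> truncation N")
    case True
    then have "card (visits w) > 0" using card_visits_pos truncation_N_subset by blast
    then show ?thesis by (simp add: weight_eq[OF True])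
  qed (simp add: weight_def)
  show "0 \<le> weight w" unfolding weight_def by (intro divide_nonneg_nonneg sum_nonneg) auto
qed

lemma weight_pos: "w \<in> truncation N \<Longrightarrow> 0 < weight w"
  using card_visits_pos truncation_N_subset by (auto simp: weight_eq)

lemma weight_partition:
  assumes w: "w \<in> truncation (6 * N)"
  shows "(\<Sum>A\<in>near. weight (act A w)) = 1"
proof -
  have "(\<Sum>A\<in>near. weight (act A w)) = (\<Sum>A\<in>near. indicator (truncation N) (act A w) / real (card (visits w)))"
  proof (rule sum.cong)
    fix A assume "A \<in> near"
    then have "A \<in> G" by (simp add: near_def)
    moreover have "w \<in> \<H>" using w truncation_subset_H by blast
    ultimately have "card (visits (act A w)) = card (visits w)" by (rule card_visits_act)
    then show "weight (act A w) = indicator (truncation N) (act A w) / real (card (visits w))"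
      by (cases "act A w \<in> truncation N") (auto simp: weight_eq, simp add: weight_def)
  qed simp
  also have "\<dots> = 1"
    using sum_near_eq_card[OF w] card_visits_pos[OF w] by (simp flip: sum_divide_distrib)
  finally show ?thesis .
qed

lemma near_inverse:
  assumes "A \<in> near" shows "matrix_inv A \<in> near"
proof -
  from assms obtain w where w: "A \<in> G" "w \<in> truncation (6 * N)" "act A w \<in> truncation (6 * N)"
    by (auto simp: near_def)
  moreover have "w \<in> \<H>" using w truncation_subset_H by blast
  ultimately have "matrix_inv A \<in> G" "act (matrix_inv A) (act A w) \<in> truncation (6 * N)"
    using inv_G act_inverse(2) by auto
  then show ?thesis using w(3) unfolding near_def by blast
qed


lemma integral_weight_pos:
  assumes "integrable hyp_measure weight"
  shows "0 < (\<integral>p. weight p \<partial>hyp_measure)"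
proof -
  obtain A where "act A \<i> \<in> truncation N"
    using cover[of \<i>] by (auto simp: upper_half_plane_def)
  then have ne: "truncation N \<noteq> {}" by blast
  have "integrable lborel (\<lambda>z. (indicator \<H> z / (Im z)\<^sup>2) *\<^sub>R weight z)"
    using assms unfolding hyp_measure_def by (subst (asm) integrable_density) auto
  then have int: "integrable lborel (\<lambda>z. indicator \<H> z * (weight z / (Im z)\<^sup>2))"
    by (simp add: mult_ac)
  have "0 < (\<integral>z. indicator \<H> z * (weight z / (Im z)\<^sup>2) \<partial>lborel)"
  proof (rule integral_pos_of_open[OF int _ open_truncation ne])
    show "0 \<le> indicator \<H> z * (weight z / (Im z)\<^sup>2)" for z
      using weight_bounds(1)[of z] by simp
    show "0 < indicator \<H> z * (weight z / (Im z)\<^sup>2)" if "z \<in> truncation N" for z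
    proof -
      have "z \<in> \<H>" using that truncation_subset_H by blast
      then show ?thesis using weight_pos[OF that] by (simp add: upper_half_plane_def)
    qed
  qed
  then show ?thesis by (simp add: integral_hyp_measure)
qed

lemma integrable_weight: "integrable hyp_measure weight"
proof (rule integrableI_bounded_set[of "truncation N" _ _ 1])
  show "AE x in hyp_measure. x \<in> truncation N \<longrightarrow> norm (weight x) \<le> 1"
    using weight_bounds by simp
  show "AE x in hyp_measure. x \<notin> truncation N \<longrightarrow> weight x = 0"
    by (simp add: weight_def)
  show "weight \<in> borel_measurable hyp_measure" by measurable
  show "emeasure hyp_measure (truncation N) < \<infinity>" by (rule emeasure_truncation_finite)
qed simp

text \<open>This replaces Stokes' theorem on the compact quotient.  The product \<open>weight p * D p w\<close> is the sum over
the group of \<open>weight (act A w) * weight p * D p w\<close>.  Applying the inverse of \<open>A\<close> to both variables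
preserves area and \<open>D\<close> and moves the factor that depends on \<open>A\<close> from \<open>w\<close> to \<open>p\<close>; exchanging the
variables then changes the sign and gives the term of the inverse of \<open>A\<close>.  So the double integral
equals its own negative.  It is essential that summation over the group is invariant under inversion:
the differences of \<open>ln Im\<close> are invariant under the real affine maps, which act transitively on \<open>\<H>\<close>, but
this group is not unimodular.\<close>

lemma integral_weight_antisymmetric:
  fixes D :: "complex \<Rightarrow> complex \<Rightarrow> real"
  assumes meas: "(\<lambda>(p, w). D p w) \<in> borel_measurable (hyp_measure \<Otimes>\<^sub>M hyp_measure)"
    and anti: "\<And>p w. D w p = - D p w"
    and inv: "\<And>A p w. A \<in> G \<Longrightarrow> p \<in> \<H> \<Longrightarrow> w \<in> \<H> \<Longrightarrow> D (act A p) (act A w) = D p w"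
    and supp: "\<And>p w. D p w \<noteq> 0 \<Longrightarrow> w \<in> hyp_disc p \<and> w \<in> \<H>"
    and bound: "\<And>p w. p \<in> truncation N \<Longrightarrow> w \<in> truncation (6 * N) \<Longrightarrow> \<bar>D p w\<bar> \<le> C"
  shows "(\<integral>p. weight p * (\<integral>w. D p w \<partial>hyp_measure) \<partial>hyp_measure) = 0"
proof -
  let ?P = "hyp_measure \<Otimes>\<^sub>M hyp_measure"
  let ?R = "truncation N \<times> truncation (6 * N)"
  define F where "F = (\<lambda>(p, w). weight p * D p w)"
  define T where "T = (\<lambda>A (p, w). weight (act A w) * (weight p * D p w))"
  have [measurable]: "(\<lambda>x. D (fst x) (snd x)) \<in> borel_measurable ?P"
    using meas by (simp add: case_prod_beta')
  have Fm[measurable]: "F \<in> borel_measurable ?P"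
    unfolding F_def case_prod_beta' by measurable
  have Tm[measurable]: "T A \<in> borel_measurable ?P" for A
    unfolding T_def case_prod_beta' by measurable
  have zero: "weight p * D p w = 0" if "(p, w) \<notin> ?R" for p w
  proof (cases "p \<in> truncation N")
    case True
    then have "w \<notin> truncation (6 * N)" using that by simp
    then have "D p w = 0" using supp[of p w] truncation_enlarge[OF True, of w] by blast
    then show ?thesis by simp
  qed (simp add: weight_def)
  have R: "emeasure ?P ?R < \<infinity>"
  proof -
    have "emeasure ?P ?R = emeasure hyp_measure (truncation N) * emeasure hyp_measure (truncation (6 * N))"
      by (rule hyp.emeasure_pair_measure_Times) simp_all
    also have "\<dots> < \<infinity>"
      using emeasure_truncation_finite[of N] emeasure_truncation_finite[of "6 * N"]
      by (simp add: ennreal_mult_less_top)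
    finally show ?thesis .
  qed
  have bnd: "\<bar>weight p * D p w\<bar> \<le> C" if "(p, w) \<in> ?R" for p w
  proof -
    have "\<bar>weight p * D p w\<bar> \<le> 1 * \<bar>D p w\<bar>"
      unfolding abs_mult using weight_bounds[of p] by (intro mult_right_mono) auto
    also have "\<dots> \<le> C" using bound that by simp
    finally show ?thesis .
  qed
  have Rm: "?R \<in> sets ?P" by (intro pair_measureI) simp_all
  have Fint: "integrable ?P F"
  proof (rule integrableI_bounded_set[OF Rm Fm R, of C])
    show "AE x in ?P. x \<in> ?R \<longrightarrow> norm (F x) \<le> C"
      using bnd by (intro AE_I2) (auto simp: F_def)
    show "AE x in ?P. x \<notin> ?R \<longrightarrow> F x = 0"
    proof (intro AE_I2 impI)
      fix x assume "x \<notin> ?R"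
      then show "F x = 0" using zero[of "fst x" "snd x"] by (simp add: F_def case_prod_beta')
    qed
  qed
  have Tint: "integrable ?P (T A)" for A
  proof (rule Bochner_Integration.integrable_bound[OF Fint Tm])
    have "norm (T A (p, w)) \<le> norm (F (p, w))" for p w
    proof -
      have "norm (T A (p, w)) = weight (act A w) * norm (F (p, w))"
        using weight_bounds[of "act A w"] by (simp add: T_def F_def abs_mult)
      also have "\<dots> \<le> 1 * norm (F (p, w))"
        using weight_bounds[of "act A w"] by (intro mult_right_mono) auto
      finally show ?thesis by simp
    qed
    then show "AE x in ?P. norm (T A x) \<le> norm (F x)" by (intro AE_I2) auto
  qed
  have F_sum: "F x = (\<Sum>A\<in>near. T A x)" for x
  proof -
    obtain p w where x: "x = (p, w)" by (cases x)
    show ?thesis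
    proof (cases "(p, w) \<in> ?R")
      case True
      then have "(\<Sum>A\<in>near. weight (act A w)) = 1" using weight_partition by simp
      then show ?thesis by (simp add: x F_def T_def flip: sum_distrib_right)
    next
      case False
      show ?thesis
        unfolding x F_def T_def prod.case zero[OF False] by simp
    qed
  qed
  \<comment> \<open>The inverse of \<open>A\<close> is substituted first in \<open>w\<close> and then in \<open>p\<close>, by Fubini's theorem; the
    remaining equalities exchange the variables.\<close>
  have flip: "(\<integral>x. T A x \<partial>?P) = - (\<integral>x. T (matrix_inv A) x \<partial>?P)" if "A \<in> near" for A
  proof -
    let ?B = "matrix_inv A"
    have A: "A \<in> G" "?B \<in> G" using that near_inverse by (auto simp: near_def)
    have inner [measurable]: "(\<lambda>p. \<integral>w. T A (p, act ?B w) \<partial>hyp_measure) \<in> borel_measurable hyp_measure"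
      by (rule hyp.borel_measurable_lebesgue_integral) (simp add: case_prod_beta', measurable)
    have "(\<integral>x. T A x \<partial>?P) = (\<integral>p. (\<integral>w. T A (p, w) \<partial>hyp_measure) \<partial>hyp_measure)"
      by (rule hyp_pair.integral_fst'[symmetric, OF Tint])
    also have "\<dots> = (\<integral>p. (\<integral>w. T A (p, act ?B w) \<partial>hyp_measure) \<partial>hyp_measure)"
    proof (rule Bochner_Integration.integral_cong[OF refl])
      fix p
      have "(\<lambda>w. T A (p, w)) \<in> borel_measurable hyp_measure" by measurable
      then have "(\<lambda>w. T A (p, w)) \<in> borel_measurable borel" by simp
      from integral_hyp_measure_act[OF this det_G[OF A(2)]]
      show "(\<integral>w. T A (p, w) \<partial>hyp_measure) = (\<integral>w. T A (p, act ?B w) \<partial>hyp_measure)" by simp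
    qed
    also have "\<dots> = (\<integral>p. (\<integral>w. T A (act ?B p, act ?B w) \<partial>hyp_measure) \<partial>hyp_measure)"
      using integral_hyp_measure_act[OF _ det_G[OF A(2)], of "\<lambda>p. \<integral>w. T A (p, act ?B w) \<partial>hyp_measure"] inner
      by simp
    also have "\<dots> = (\<integral>p. (\<integral>w. - T ?B (w, p) \<partial>hyp_measure) \<partial>hyp_measure)"
    proof (rule integral_cong_AE)
      show "AE p in hyp_measure. (\<integral>w. T A (act ?B p, act ?B w) \<partial>hyp_measure) = (\<integral>w. - T ?B (w, p) \<partial>hyp_measure)"
        using AE_hyp_measure_H
      proof eventually_elim
        case p: (elim p)
        show ?case
        proof (rule integral_cong_AE)
          show "AE w in hyp_measure. T A (act ?B p, act ?B w) = - T ?B (w, p)"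
            using AE_hyp_measure_H
          proof eventually_elim
            case (elim w)
            have "D (act ?B p) (act ?B w) = - D w p" using inv[OF A(2) p elim] anti[of w p] by simp
            then show ?case using act_inverse(1)[OF A(1) elim] by (simp add: T_def)
          qed
        qed measurable
      qed
    qed measurable
    also have "\<dots> = (\<integral>w. (\<integral>p. - T ?B (w, p) \<partial>hyp_measure) \<partial>hyp_measure)"
      by (rule hyp_pair.Fubini_integral[of "\<lambda>w p. - T ?B (w, p)"]) (simp add: case_prod_beta' Tint)
    also have "\<dots> = (\<integral>x. - T ?B x \<partial>?P)"
      by (rule hyp_pair.integral_fst'[of "\<lambda>x. - T ?B x"]) (simp add: Tint)
    finally show ?thesis by simp
  qed
  have "(\<integral>x. F x \<partial>?P) = (\<Sum>A\<in>near. \<integral>x. T A x \<partial>?P)"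
    unfolding F_sum by (rule Bochner_Integration.integral_sum) (rule Tint)
  also have "\<dots> = (\<Sum>A\<in>near. - (\<integral>x. T (matrix_inv A) x \<partial>?P))"
    by (rule sum.cong) (simp_all add: flip)
  also have "\<dots> = - (\<Sum>A\<in>near. \<integral>x. T A x \<partial>?P)"
    unfolding sum_negf neg_equal_iff_equal
    by (rule sum.reindex_bij_witness[where i = matrix_inv and j = matrix_inv])
       (auto simp: near_inverse, auto simp: near_def inverse_G)
  also have "(\<Sum>A\<in>near. \<integral>x. T A x \<partial>?P) = (\<integral>x. F x \<partial>?P)"
    unfolding F_sum by (rule Bochner_Integration.integral_sum[symmetric]) (rule Tint)
  finally have "(\<integral>x. F x \<partial>?P) = 0" by simp
  moreover have "(\<integral>x. F x \<partial>?P) = (\<integral>p. (\<integral>w. F (p, w) \<partial>hyp_measure) \<partial>hyp_measure)"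
    by (rule hyp_pair.integral_fst'[symmetric, OF Fint])
  ultimately show ?thesis by (simp add: F_def)
qed

end

section \<open>A potential for the cocycle\<close>

lemma slash_2: "slash 2 E A \<tau> = E (act A \<tau>) / (J A \<tau>)\<^sup>2"
  by (simp add: slash_def power_int_minus field_simps)

lemma has_field_derivative_J: "(J A has_field_derivative of_real (A$2$1)) (at \<tau>)"
  unfolding J_def by (auto intro!: derivative_eq_intros)

text \<open>Let \<open>g\<close> be a primitive of \<open>E\<close>.  The law says that \<open>exp (g (act A \<tau>) - g \<tau>)\<close> and \<open>J A \<tau>\<close> have the same
logarithmic derivative, so their quotient is constant.  Hence
\<open>2 * Re g + ln Im\<close> is invariant up to additive constants, although in general neither
summand is.\<close>

lemma potential_act:
  assumes g: "\<And>\<tau>. \<tau> \<in> \<H> \<Longrightarrow> (g has_field_derivative E \<tau>) (at \<tau>)"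
    and A: "det A = 1"
    and law: "\<And>\<tau>. \<tau> \<in> \<H> \<Longrightarrow> slash 2 E A \<tau> = E \<tau> + X_cocycle A \<tau>"
  obtains \<kappa> where "\<And>\<tau>. \<tau> \<in> \<H> \<Longrightarrow>
    2 * Re (g (act A \<tau>)) + ln (Im (act A \<tau>)) = (2 * Re (g \<tau>) + ln (Im \<tau>)) + \<kappa>"
proof -
  \<comment> \<open>Dividing the exponential by \<open>J\<close> avoids a choice of logarithm.\<close>
  define q where "q = (\<lambda>\<tau>. exp (g (act A \<tau>) - g \<tau>) / J A \<tau>)"
  have "(q has_field_derivative 0) (at \<tau> within \<H>)" if \<tau>: "\<tau> \<in> \<H>" for \<tau>
  proof -
    have n: "J A \<tau> \<noteq> 0" using J_nonzero[OF A \<tau>] .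
    have 1: "((\<lambda>\<tau>. g (act A \<tau>)) has_field_derivative E (act A \<tau>) * (1 / (J A \<tau>)\<^sup>2)) (at \<tau>)"
      using DERIV_chain2[OF g[OF act_in_H[OF A \<tau>]] has_field_derivative_act[OF A \<tau>]] .
    have "(q has_field_derivative
       (exp (g (act A \<tau>) - g \<tau>) * (E (act A \<tau>) * (1 / (J A \<tau>)\<^sup>2) - E \<tau>) * J A \<tau>
         - exp (g (act A \<tau>) - g \<tau>) * of_real (A$2$1)) / (J A \<tau> * J A \<tau>)) (at \<tau>)"
      unfolding q_def
      by (rule DERIV_divide[OF DERIV_chain2[OF DERIV_exp DERIV_diff[OF 1 g[OF \<tau>]]] has_field_derivative_J n])
    also have "E (act A \<tau>) * (1 / (J A \<tau>)\<^sup>2) - E \<tau> = of_real (A$2$1) / J A \<tau>"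
      using law[OF \<tau>] by (simp add: slash_2 X_cocycle_def)
    finally show ?thesis using n by (simp add: has_field_derivative_at_within)
  qed
  then obtain c where c: "\<And>\<tau>. \<tau> \<in> \<H> \<Longrightarrow> q \<tau> = c"
    using has_field_derivative_zero_constant[OF convex_H] by metis
  have "2 * Re (g (act A \<tau>)) + ln (Im (act A \<tau>)) = (2 * Re (g \<tau>) + ln (Im \<tau>)) + 2 * ln (norm c)"
    if \<tau>: "\<tau> \<in> \<H>" for \<tau>
  proof -
    have n: "norm (J A \<tau>) > 0" using J_nonzero[OF A \<tau>] by simp
    have "norm c = exp (Re (g (act A \<tau>) - g \<tau>)) / norm (J A \<tau>)"
      using c[OF \<tau>] by (auto simp: q_def norm_divide)
    then have "ln (norm c) = Re (g (act A \<tau>)) - Re (g \<tau>) - ln (norm (J A \<tau>))"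
      using n by (simp add: ln_div)
    moreover have "ln (Im (act A \<tau>)) = ln (Im \<tau>) - 2 * ln (norm (J A \<tau>))"
      using n \<tau> by (simp add: Im_act[OF A \<tau>] ln_div ln_realpow upper_half_plane_def)
    ultimately show ?thesis by simp
  qed
  then show ?thesis by (rule that)
qed

context cocompact_lattice
begin

text \<open>The differences \<open>u w - u p\<close> of the potential \<open>u\<close> are invariant and antisymmetric, so their weighted
double integral over pairs of nearby points vanishes; but \<open>u\<close> is strictly superharmonic, so the inner
integral over the disc about \<open>p\<close> is the same negative number for all \<open>p\<close>.\<close>

theorem no_quasiautomorphic_cocycle:
  assumes hol: "E holomorphic_on \<H>"
    and law: "\<And>A \<tau>. A \<in> G \<Longrightarrow> \<tau> \<in> \<H> \<Longrightarrow> slash 2 E A \<tau> = E \<tau> + X_cocycle A \<tau>"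
  shows False
proof -
  obtain g0 where g0: "\<And>\<tau>. \<tau> \<in> \<H> \<Longrightarrow> (g0 has_field_derivative E \<tau>) (at \<tau> within \<H>)"
    using holomorphic_convex_primitive'[OF convex_H open_H hol] by metis
  \<comment> \<open>Outside \<open>\<H>\<close> the primitive is unspecified; the value 0 makes it Borel measurable.\<close>
  define g where "g = (\<lambda>\<tau>. if \<tau> \<in> \<H> then g0 \<tau> else 0)"
  have g: "(g has_field_derivative E \<tau>) (at \<tau>)" if "\<tau> \<in> \<H>" for \<tau>
  proof (rule has_field_derivative_transform_within_open[OF _ open_H that])
    show "(g0 has_field_derivative E \<tau>) (at \<tau>)"
      using g0[OF that] at_within_open[OF that open_H] by simp
  qed (simp add: g_def)
  then have ghol: "g holomorphic_on \<H>"
    by (auto simp: holomorphic_on_open[OF open_H])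
  have "continuous_on \<H> g0"
    using g0 by (meson continuous_on_eq_continuous_within DERIV_continuous)
  then have gm[measurable]: "g \<in> borel_measurable borel"
    unfolding g_def by (intro borel_measurable_continuous_on_if) auto
  define u where "u = (\<lambda>w. 2 * Re (g w) + ln (Im w))"
  have um[measurable]: "u \<in> borel_measurable borel" unfolding u_def by measurable
  define D where "D = (\<lambda>p w. if p \<in> \<H> \<and> w \<in> \<H> \<and> w \<in> hyp_disc p then u w - u p else 0)"
  have "(\<integral>p. weight p * (\<integral>w. D p w \<partial>hyp_measure) \<partial>hyp_measure) = 0"
  proof -
    obtain K where K: "compact K" "truncation (6 * N) \<subseteq> K" "K \<subseteq> \<H>"
      using truncation_in_compact[of "6 * N"] N_pos by auto
    have "continuous_on K u"
      unfolding u_def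
      using K(3) by (intro continuous_intros continuous_on_subset[OF holomorphic_on_imp_continuous_on[OF ghol]])
        (auto simp: upper_half_plane_def)
    then have "bounded (u ` K)" using K(1) compact_continuous_image compact_imp_bounded by blast
    then obtain C where C: "\<And>w. w \<in> K \<Longrightarrow> \<bar>u w\<bar> \<le> C"
      unfolding bounded_iff by (auto simp: image_iff)
    show ?thesis
    proof (rule integral_weight_antisymmetric[where C = "2 * C"])
      show "(\<lambda>(p, w). D p w) \<in> borel_measurable (hyp_measure \<Otimes>\<^sub>M hyp_measure)"
        unfolding D_def hyp_disc_def mem_Collect_eq case_prod_beta' by measurable
      show "D w p = - D p w" for p w
        using hyp_disc_sym[of w p] by (simp add: D_def)
      show "D (act A p) (act A w) = D p w" if "A \<in> G" "p \<in> \<H>" "w \<in> \<H>" for A p w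
      proof -
        note A = \<open>A \<in> G\<close>
        obtain \<kappa> where "\<And>\<tau>. \<tau> \<in> \<H> \<Longrightarrow> u (act A \<tau>) = u \<tau> + \<kappa>"
          unfolding u_def by (rule potential_act[of g E A]) (use g det_G[OF A] law[OF A] in auto)
        then show ?thesis
          using that by (simp add: D_def hyp_disc_act_iff det_G act_in_H)
      qed
      show "w \<in> hyp_disc p \<and> w \<in> \<H>" if "D p w \<noteq> 0" for p w
        using that by (auto simp: D_def split: if_splits)
      show "\<bar>D p w\<bar> \<le> 2 * C" if "p \<in> truncation N" "w \<in> truncation (6 * N)" for p w
      proof -
        have "p \<in> K" "w \<in> K" using that truncation_N_subset K(2) by auto
        then have "\<bar>u p\<bar> \<le> C" "\<bar>u w\<bar> \<le> C" using C by auto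
        then have "\<bar>u w - u p\<bar> \<le> 2 * C" "0 \<le> 2 * C" by linarith+
        then show ?thesis by (simp add: D_def)
      qed
    qed
  qed
  moreover have "(\<integral>p. weight p * (\<integral>w. D p w \<partial>hyp_measure) \<partial>hyp_measure)
      = (\<integral>p. weight p * disc_defect \<partial>hyp_measure)"
  proof (rule Bochner_Integration.integral_cong[OF refl])
    fix p
    show "weight p * (\<integral>w. D p w \<partial>hyp_measure) = weight p * disc_defect"
    proof (cases "p \<in> truncation N")
      case True
      then have p: "p \<in> \<H>" using truncation_subset_H by blast
      have [measurable]: "hyp_disc p \<in> sets borel" unfolding hyp_disc_def by measurable
      have "(\<integral>w. D p w \<partial>hyp_measure) = (\<integral>w. indicator (hyp_disc p) w * (u w - u p) \<partial>hyp_measure)"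
      proof (rule integral_cong_AE)
        show "AE w in hyp_measure. D p w = indicator (hyp_disc p) w * (u w - u p)"
          using AE_hyp_measure_H by eventually_elim (use p in \<open>auto simp: D_def\<close>)
        show "D p \<in> borel_measurable hyp_measure" unfolding D_def by measurable
      qed measurable
      also have "\<dots> = disc_defect"
        using hyp_disc_average[OF ghol gm p] by (simp add: u_def)
      finally show ?thesis by simp
    qed (simp add: weight_def)
  qed
  ultimately show False
    using integral_weight_pos[OF integrable_weight] disc_defect_neg by simp
qed

end

section \<open>Infinitely many cocycle values\<close>

text \<open>A value \<open>c / (c * \<tau> + d)\<close> at a single nonreal point determines the ratio of the real numbers \<open>c\<close> and
\<open>d\<close>, and hence the whole function.\<close>

lemma X_cocycle_eqI:
  assumes "det A = 1" "det B = 1" "\<tau> \<in> \<H>" "X_cocycle A \<tau> = X_cocycle B \<tau>"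
  shows "X_cocycle A = X_cocycle B"
proof -
  let ?c = "A$2$1" and ?d = "A$2$2" and ?c' = "B$2$1" and ?d' = "B$2$2"
  have n: "J A \<tau> \<noteq> 0" "J B \<tau> \<noteq> 0" using assms J_nonzero by auto
  have "of_real ?c * J B \<tau> = of_real ?c' * J A \<tau>"
    using assms(4) n by (simp add: X_cocycle_def field_simps)
  then have "of_real (?c * ?d') = (of_real (?c' * ?d) :: complex)"
    by (simp add: J_def algebra_simps)
  then have cd: "?c * ?d' = ?c' * ?d" by (simp only: of_real_eq_iff)
  have "?c \<noteq> 0 \<or> ?d \<noteq> 0" "?c' \<noteq> 0 \<or> ?d' \<noteq> 0"
    using assms(1,2) by (auto simp: det_2)
  then obtain k where k: "k \<noteq> 0" "?c' = k * ?c" "?d' = k * ?d"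
  proof (cases "?c = 0")
    case True
    then have "?d \<noteq> 0" "?c' = 0" using \<open>?c \<noteq> 0 \<or> ?d \<noteq> 0\<close> cd by auto
    then show ?thesis using that[of "?d' / ?d"] \<open>?c' \<noteq> 0 \<or> ?d' \<noteq> 0\<close> True by auto
  next
    case False
    then have "?d' = ?c' / ?c * ?d" using cd by (simp add: field_simps)
    moreover from this have "?c' \<noteq> 0" using \<open>?c' \<noteq> 0 \<or> ?d' \<noteq> 0\<close> by auto
    ultimately show ?thesis using that[of "?c' / ?c"] False by auto
  qed
  show ?thesis
  proof
    fix z
    have "J B z = of_real k * J A z" by (simp add: J_def k algebra_simps)
    then show "X_cocycle A z = X_cocycle B z" using k(1) by (simp add: X_cocycle_def k(2))
  qed
qed

lemma X_mat_1 [simp]: "X_cocycle (mat 1) \<tau> = 0"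
  by (simp add: X_cocycle_def) (simp add: mat_def)

lemma holomorphic_X: "det A = 1 \<Longrightarrow> X_cocycle A holomorphic_on \<H>"
  using J_nonzero unfolding X_cocycle_def J_def by (auto intro!: holomorphic_intros)

context cocompact_lattice
begin

text \<open>The functions \<open>X_cocycle A\<close> correspond to the points of the orbit of \<open>\<infinity>\<close>.  If there were only
finitely many, the group would permute them up to the cocycle, and minus their mean would be a
solution of the equation just shown to be unsolvable.\<close>

lemma infinite_X_functions: "infinite (X_cocycle ` G)"
proof
  assume fin: "finite (X_cocycle ` G)"
  let ?\<Phi> = "X_cocycle ` G"
  have card: "card ?\<Phi> > 0" using fin one_G by (auto simp: card_gt_0_iff)
  define E where "E = (\<lambda>\<tau>. - (\<Sum>F\<in>?\<Phi>. F \<tau>) / of_nat (card ?\<Phi>))"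
  have "E holomorphic_on \<H>"
    unfolding E_def using card holomorphic_X det_G by (auto intro!: holomorphic_intros)
  moreover have "slash 2 E B \<tau> = E \<tau> + X_cocycle B \<tau>" if B: "B \<in> G" and \<tau>: "\<tau> \<in> \<H>" for B \<tau>
  proof -
    \<comment> \<open>Right translation by \<open>B\<close> permutes the functions; representatives define the permutation.\<close>
    define R where "R = (\<lambda>F. SOME A. A \<in> G \<and> X_cocycle A = F)"
    have R: "R F \<in> G" "X_cocycle (R F) = F" if "F \<in> ?\<Phi>" for F
      using that someI_ex[of "\<lambda>A. A \<in> G \<and> X_cocycle A = F"] by (auto simp: R_def)
    define T where "T = (\<lambda>F. X_cocycle (R F ** B))"
    have T_eq: "T F \<tau> = F (act B \<tau>) / (J B \<tau>)\<^sup>2 + X_cocycle B \<tau>" if "F \<in> ?\<Phi>" for F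
      using X_mult[of "R F" B \<tau>] R[OF that] det_G B \<tau> by (simp add: T_def)
    have "T ` ?\<Phi> \<subseteq> ?\<Phi>" using R mult_G B by (auto simp: T_def)
    moreover have "inj_on T ?\<Phi>"
    proof (rule inj_onI)
      fix F F' assume F: "F \<in> ?\<Phi>" "F' \<in> ?\<Phi>" and eq: "T F = T F'"
      have "F (act B \<tau>) = F' (act B \<tau>)"
        using T_eq[OF F(1)] T_eq[OF F(2)] eq J_nonzero[OF det_G[OF B] \<tau>] by simp
      then have "X_cocycle (R F) (act B \<tau>) = X_cocycle (R F') (act B \<tau>)" using R F by simp
      then have "X_cocycle (R F) = X_cocycle (R F')"
        using X_cocycle_eqI det_G R(1) F act_in_H[OF det_G[OF B] \<tau>] by blast
      then show "F = F'" using R F by simp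
    qed
    ultimately have bij: "bij_betw T ?\<Phi> ?\<Phi>"
      using fin by (simp add: bij_betw_def endo_inj_surj)
    have "(\<Sum>F\<in>?\<Phi>. F \<tau>) = (\<Sum>F\<in>?\<Phi>. T F \<tau>)"
      using sum.reindex_bij_betw[OF bij, of "\<lambda>F. F \<tau>"] by simp
    also have "\<dots> = (\<Sum>F\<in>?\<Phi>. F (act B \<tau>) / (J B \<tau>)\<^sup>2 + X_cocycle B \<tau>)"
      by (intro sum.cong refl T_eq)
    also have "\<dots> = (\<Sum>F\<in>?\<Phi>. F (act B \<tau>)) / (J B \<tau>)\<^sup>2 + of_nat (card ?\<Phi>) * X_cocycle B \<tau>"
      by (simp add: sum.distrib sum_divide_distrib)
    finally show ?thesis
      using card J_nonzero[OF det_G[OF B] \<tau>]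
      by (simp add: slash_2 E_def field_simps)
  qed
  ultimately show False by (rule no_quasiautomorphic_cocycle)
qed

text \<open>This makes the coefficients of a quasi-automorphic form unique: they are the coefficients of a
polynomial that is known at infinitely many points.\<close>

lemma infinite_X_values:
  assumes \<tau>: "\<tau> \<in> \<H>"
  shows "infinite ((\<lambda>A. X_cocycle A \<tau>) ` G)"
proof -
  have "inj_on (\<lambda>F. F \<tau>) (X_cocycle ` G)"
    using X_cocycle_eqI[OF det_G det_G \<tau>] by (auto simp: inj_on_def)
  then have "infinite ((\<lambda>F. F \<tau>) ` (X_cocycle ` G))"
    using infinite_X_functions finite_image_iff by blast
  then show ?thesis by (simp add: image_image)
qed

section \<open>Automorphic forms of nonpositive weight\<close>

lemma invariant_attains_max:
  fixes v :: "complex \<Rightarrow> real"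
  assumes cont: "continuous_on \<H> v" and inv: "\<And>A \<tau>. A \<in> G \<Longrightarrow> \<tau> \<in> \<H> \<Longrightarrow> v (act A \<tau>) = v \<tau>"
  obtains p where "p \<in> \<H>" "\<And>\<tau>. \<tau> \<in> \<H> \<Longrightarrow> v \<tau> \<le> v p"
proof -
  obtain K where K: "compact K" "truncation N \<subseteq> K" "K \<subseteq> \<H>"
    using truncation_in_compact[OF N_pos] .
  obtain A where "act A \<i> \<in> truncation N"
    using cover[of \<i>] by (auto simp: upper_half_plane_def)
  then have "K \<noteq> {}" using K by blast
  then obtain p where p: "p \<in> K" "\<And>\<tau>. \<tau> \<in> K \<Longrightarrow> v \<tau> \<le> v p"
    using continuous_attains_sup[OF K(1) _ continuous_on_subset[OF cont K(3)]] by blast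
  show ?thesis
  proof (rule that)
    show "p \<in> \<H>" using p K by blast
    fix \<tau> assume \<tau>: "\<tau> \<in> \<H>"
    obtain A where "A \<in> G" "act A \<tau> \<in> truncation N" using cover[OF \<tau>] by blast
    then show "v \<tau> \<le> v p" using inv[of A \<tau>] p(2)[of "act A \<tau>"] \<tau> K by auto
  qed
qed

text \<open>The function \<open>norm (f \<tau>) / Im \<tau> ^ n\<close> is invariant and attains its maximum at some \<open>p\<close>.  In the chart
about \<open>p\<close> this bounds a holomorphic function by \<open>(1 - (norm z)\<^sup>2) ^ n\<close> times its value at the centre, so
it is constant by the maximum modulus principle, and zero if \<open>n > 0\<close>.\<close>

lemma nonpositive_weight:
  assumes hol: "f holomorphic_on \<H>"
    and law: "\<And>A \<tau>. A \<in> G \<Longrightarrow> \<tau> \<in> \<H> \<Longrightarrow> J A \<tau> ^ (2 * n) * f (act A \<tau>) = f \<tau>"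
  obtains c where "\<And>\<tau>. \<tau> \<in> \<H> \<Longrightarrow> f \<tau> = c" "n > 0 \<Longrightarrow> c = 0"
proof -
  define v where "v = (\<lambda>\<tau>. norm (f \<tau>) / Im \<tau> ^ n)"
  have "continuous_on \<H> v"
    unfolding v_def
    by (intro continuous_intros holomorphic_on_imp_continuous_on hol) (auto simp: upper_half_plane_def)
  moreover have "v (act A \<tau>) = v \<tau>" if A: "A \<in> G" and \<tau>: "\<tau> \<in> \<H>" for A \<tau>
  proof -
    have n: "J A \<tau> \<noteq> 0" using J_nonzero[OF det_G[OF A] \<tau>] .
    have "norm (f \<tau>) = norm (J A \<tau>) ^ (2 * n) * norm (f (act A \<tau>))"
      using law[OF A \<tau>] by (metis norm_mult norm_power)
    then show ?thesis
      using n \<tau> by (simp add: v_def Im_act[OF det_G[OF A] \<tau>] power_divide power_mult)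
  qed
  ultimately obtain p where p: "p \<in> \<H>" and max: "\<And>\<tau>. \<tau> \<in> \<H> \<Longrightarrow> v \<tau> \<le> v p"
    using invariant_attains_max by metis
  have yp: "Im p > 0" using p by (simp add: upper_half_plane_def)
  define R where "R = (\<lambda>z. f (disc_chart p z) * (1 - z) ^ (2 * n))"
  have chart: "disc_chart p z \<in> \<H>" if "norm z < 1" for z
    using bij_betw_disc_chart[OF p] that by (auto simp: bij_betw_def)
  have "disc_chart p holomorphic_on ball 0 1"
    using has_field_derivative_disc_chart
    by (intro holomorphic_onI) (auto simp: field_differentiable_def intro: has_field_derivative_at_within)
  then have "(\<lambda>z. f (disc_chart p z)) holomorphic_on ball 0 1"
    by (rule holomorphic_on_compose_gen[OF _ hol, unfolded o_def]) (use chart in auto)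
  then have Rhol: "R holomorphic_on ball 0 1"
    unfolding R_def by (intro holomorphic_intros)
  have R0: "R 0 = f p" by (simp add: R_def)
  have bound: "norm (R z) \<le> (1 - (norm z)\<^sup>2) ^ n * norm (R 0)" if z: "norm z < 1" for z
  proof -
    have s: "norm (1 - z) > 0" "1 - (norm z)\<^sup>2 > 0" using z by (auto simp: abs_square_less_1)
    have "v (disc_chart p z) \<le> v p" using max chart[OF z] .
    then have "norm (f (disc_chart p z)) \<le> norm (f p) / Im p ^ n * Im (disc_chart p z) ^ n"
      using chart[OF z] by (simp add: v_def upper_half_plane_def divide_le_eq)
    also have "\<dots> = norm (f p) * (1 - (norm z)\<^sup>2) ^ n / norm (1 - z) ^ (2 * n)"
      using yp by (simp add: Im_disc_chart[OF z] power_divide power_mult_distrib power_mult)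
    finally show ?thesis
      using s by (simp add: R_def norm_mult norm_power field_simps)
  qed
  have "R constant_on ball 0 1"
  proof (rule maximum_modulus_principle[OF Rhol, of "ball 0 1" 0])
    fix z :: complex assume "z \<in> ball 0 1"
    then have z: "norm z < 1" by simp
    have "(1 - (norm z)\<^sup>2) ^ n \<le> 1"
      using z by (intro power_le_one) (auto simp: abs_square_le_1)
    then show "norm (R z) \<le> norm (R 0)"
      using bound[OF z] by (smt (verit) mult_left_le_one_le mult_right_mono norm_ge_zero)
  qed auto
  then have Rc: "R z = f p" if "norm z < 1" for z
    using that R0 unfolding constant_on_def by (metis centre_in_ball mem_ball_0 zero_less_one)
  have zero: "f p = 0" if "n > 0"
  proof (rule ccontr)
    assume "f p \<noteq> 0"
    then have "1 \<le> (1 - (norm (1/2::complex))\<^sup>2) ^ n"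
      using bound[of "1/2"] Rc[of "1/2"] R0 by simp
    also have "1 - (norm (1/2::complex))\<^sup>2 = 3/4"
      by (simp add: norm_divide power2_eq_square)
    finally have "1 \<le> (3/4::real) ^ n" .
    moreover have "(3/4::real) ^ n < 1"
      using power_strict_decreasing[of 0 n "3/4::real"] that by simp
    ultimately show False by simp
  qed
  show ?thesis
  proof (rule that)
    fix \<tau> assume "\<tau> \<in> \<H>"
    then have "\<tau> \<in> disc_chart p ` ball 0 1"
      using bij_betw_disc_chart[OF p] by (simp add: bij_betw_def)
    then obtain z where z: "norm z < 1" "\<tau> = disc_chart p z" by auto
    have "R z = f p" using Rc z by simp
    moreover have "1 - z \<noteq> 0" using z by auto
    ultimately show "f \<tau> = f p" using zero by (cases "n = 0") (auto simp: R_def z(2))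
  qed (rule zero)
qed


section \<open>Coefficients of quasi-automorphic forms\<close>

text \<open>Compare the expansions at \<open>\<tau>\<close> and at \<open>act B \<tau>\<close>.  Since \<open>X_cocycle\<close> is a cocycle, both express the same
function as a polynomial in \<open>X_cocycle (A ** B) \<tau>\<close>, and as this takes infinitely many values the leading
coefficients agree.\<close>

lemma quasi_top_coefficient:
  assumes law: "\<And>A \<tau>. A \<in> G \<Longrightarrow> \<tau> \<in> \<H> \<Longrightarrow> slash 2 f A \<tau> = (\<Sum>m\<le>Suc n. X_cocycle A \<tau> ^ m * Q m \<tau>)"
    and B: "B \<in> G" and \<tau>: "\<tau> \<in> \<H>"
  shows "J B \<tau> ^ (2 * n) * Q (Suc n) (act B \<tau>) = Q (Suc n) \<tau>"
proof -
  let ?j = "J B \<tau>" and ?x = "X_cocycle B \<tau>"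
  have j: "?j \<noteq> 0" using J_nonzero[OF det_G[OF B] \<tau>] .
  have B\<tau>: "act B \<tau> \<in> \<H>" using act_in_H[OF det_G[OF B] \<tau>] .
  define P where "P = (\<Sum>m\<le>Suc n. Polynomial.monom (Q m \<tau>) m)"
  define R where "R = (\<Sum>m\<le>Suc n. Polynomial.smult (?j ^ (2 * m) / ?j\<^sup>2 * Q m (act B \<tau>)) ([:- ?x, 1:] ^ m))"
  have "poly P x = poly R x" if "x \<in> (\<lambda>A. X_cocycle A \<tau>) ` G" for x
  proof -
    from that obtain A' where A': "A' \<in> G" "x = X_cocycle A' \<tau>" by blast
    \<comment> \<open>Every element is of the form \<open>A ** B\<close>, so the values of \<open>X_cocycle (A ** B) \<tau>\<close> are all values.\<close>
    define A where "A = A' ** matrix_inv B"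
    have A: "A \<in> G" "A ** B = A'"
      using A' B mult_G inv_G inverse_G[OF B] by (auto simp: A_def simp flip: matrix_mul_assoc)
    have X: "X_cocycle A (act B \<tau>) = ?j\<^sup>2 * (x - ?x)"
      using X_mult[OF det_G[OF A(1)] det_G[OF B] \<tau>] j by (simp add: A A'(2) field_simps)
    have "poly P x = slash 2 f A' \<tau>"
      by (simp only: law[OF A'(1) \<tau>] P_def poly_sum poly_monom A'(2) mult.commute)
    also have "\<dots> = slash 2 f A (act B \<tau>) / ?j\<^sup>2"
      using det_G[OF A(1)] det_G[OF B] \<tau>
      by (simp add: A(2)[symmetric] slash_2 act_mult J_mult power_mult_distrib)
    also have "\<dots> = (\<Sum>m\<le>Suc n. (?j\<^sup>2 * (x - ?x)) ^ m * Q m (act B \<tau>)) / ?j\<^sup>2"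
      by (simp only: law[OF A(1) B\<tau>] X)
    also have "\<dots> = poly R x"
      unfolding R_def poly_sum sum_divide_distrib
      by (intro sum.cong refl) (simp add: poly_power power_mult_distrib mult_ac flip: power_mult)
    finally show ?thesis .
  qed
  then have "(\<lambda>A. X_cocycle A \<tau>) ` G \<subseteq> {x. poly (P - R) x = 0}" by auto
  then have "infinite {x. poly (P - R) x = 0}"
    using infinite_X_values[OF \<tau>] infinite_super by blast
  then have "P = R" using poly_roots_finite[of "P - R"] by auto
  then have "Q (Suc n) \<tau> = Polynomial.coeff R (Suc n)"
    by (simp add: P_def Polynomial.coeff_sum flip: \<open>P = R\<close>)
  also have "\<dots> = (\<Sum>m\<le>Suc n. ?j ^ (2 * m) / ?j\<^sup>2 * Q m (act B \<tau>) * Polynomial.coeff ([:- ?x, 1:] ^ m) (Suc n))"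
    by (simp only: R_def Polynomial.coeff_sum Polynomial.coeff_smult)
  also have "\<dots> = ?j ^ (2 * Suc n) / ?j\<^sup>2 * Q (Suc n) (act B \<tau>)"
  proof -
    have low: "Polynomial.coeff ([:- ?x, 1:] ^ m) (Suc n) = 0" if "m \<le> n" for m
      using that by (intro Polynomial.coeff_eq_0) (simp add: degree_linear_power)
    have "(\<Sum>m\<le>n. ?j ^ (2 * m) / ?j\<^sup>2 * Q m (act B \<tau>) * Polynomial.coeff ([:- ?x, 1:] ^ m) (Suc n)) = 0"
      by (rule sum.neutral) (simp add: low)
    then show ?thesis
      by (simp only: sum.atMost_Suc coeff_linear_power add_0 mult_1_right)
  qed
  also have "?j ^ (2 * Suc n) / ?j\<^sup>2 = ?j ^ (2 * n)"
    using j by (simp add: power_add power2_eq_square)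
  finally show ?thesis by simp
qed

text \<open>The top coefficient of depth \<open>s\<close> has weight \<open>2 - 2 * s\<close>.  It vanishes if \<open>s > 1\<close>, and this lowers the
depth.  If \<open>s = 1\<close> it is a constant, which is zero because the cocycle equation has no solution.\<close>

lemma quasi_coefficients_vanish:
  assumes hol: "f holomorphic_on \<H>"
    and Q: "\<And>m. m \<le> s \<Longrightarrow> Q m holomorphic_on \<H>"
    and law: "\<And>A \<tau>. A \<in> G \<Longrightarrow> \<tau> \<in> \<H> \<Longrightarrow> slash 2 f A \<tau> = (\<Sum>m\<le>s. X_cocycle A \<tau> ^ m * Q m \<tau>)"
    and m: "1 \<le> m" "m \<le> s" and \<tau>: "\<tau> \<in> \<H>"
  shows "Q m \<tau> = 0"
  using Q law m
proof (induction s)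
  case (Suc n)
  have "J A \<tau> ^ (2 * n) * Q (Suc n) (act A \<tau>) = Q (Suc n) \<tau>" if "A \<in> G" "\<tau> \<in> \<H>" for A \<tau>
    using quasi_top_coefficient[OF Suc.prems(2) that] by simp
  then obtain c where c: "\<And>\<tau>. \<tau> \<in> \<H> \<Longrightarrow> Q (Suc n) \<tau> = c" "n > 0 \<Longrightarrow> c = 0"
    using nonpositive_weight[OF Suc.prems(1)[OF order_refl], of n] by metis
  have top: "c = 0"
  proof (cases "n = 0")
    case True
    show ?thesis
    proof (rule ccontr)
      assume "c \<noteq> 0"
      have law1: "slash 2 f A \<tau> = Q 0 \<tau> + c * X_cocycle A \<tau>" if "A \<in> G" "\<tau> \<in> \<H>" for A \<tau>
        using Suc.prems(2)[OF that] c(1)[OF that(2)] True by simp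
      have f: "f \<tau> = Q 0 \<tau>" if "\<tau> \<in> \<H>" for \<tau>
        using law1[OF one_G that] by (simp add: slash_2)
      show False
      proof (rule no_quasiautomorphic_cocycle[of "\<lambda>\<tau>. f \<tau> / c"])
        show "(\<lambda>\<tau>. f \<tau> / c) holomorphic_on \<H>"
          using hol \<open>c \<noteq> 0\<close> by (intro holomorphic_intros) auto
        show "slash 2 (\<lambda>\<tau>. f \<tau> / c) A \<tau> = f \<tau> / c + X_cocycle A \<tau>" if "A \<in> G" "\<tau> \<in> \<H>" for A \<tau>
          using law1[OF that] f[OF that(2)] \<open>c \<noteq> 0\<close> by (simp add: slash_2 field_simps)
      qed
    qed
  qed (use c in auto)
  show ?case
  proof (cases "m = Suc n")
    case False
    have "slash 2 f A \<tau> = (\<Sum>m\<le>n. X_cocycle A \<tau> ^ m * Q m \<tau>)" if "A \<in> G" "\<tau> \<in> \<H>" for A \<tau>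
      using Suc.prems(2)[OF that] c(1)[OF that(2)] top by simp
    then show ?thesis
      using Suc.IH Suc.prems False by simp
  qed (use c(1)[OF \<tau>] top in simp)
qed simp

end

section \<open>Lifts of a cocompact Fuchsian group\<close>

lemma matrix_inv_eqI:
  fixes A B :: "real^2^2"
  assumes "A ** B = mat 1" "B ** A = mat 1"
  shows "matrix_inv A = B"
proof -
  have inv: "A ** matrix_inv A = mat 1 \<and> matrix_inv A ** A = mat 1"
    unfolding matrix_inv_def by (rule someI[of _ B]) (use assms in simp)
  have "matrix_inv A = matrix_inv A ** (A ** B)" using assms by simp
  also have "\<dots> = (matrix_inv A ** A) ** B" by (simp only: matrix_mul_assoc)
  finally show ?thesis using inv by simp
qed

lemma matrix_inv_SL2:
  fixes A :: "real^2^2"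
  assumes "det A = 1"
  shows "matrix_inv A = vector [vector [A$2$2, - A$1$2], vector [- A$2$1, A$1$1]]"
  using assms by (intro matrix_inv_eqI)
    (simp_all add: vec_eq_iff forall_2 matrix_mult_2 mat_def det_2 algebra_simps)

lemma norm_matrix_2_le:
  fixes M :: "real^2^2"
  assumes "\<And>i j. \<bar>M$i$j\<bar> \<le> d"
  shows "norm M \<le> 4 * d"
proof -
  have "norm M \<le> (\<Sum>i\<in>UNIV. norm (M$i))"
    unfolding norm_vec_def by (rule L2_set_le_sum) simp
  also have "\<dots> \<le> (\<Sum>i\<in>(UNIV::2 set). 2 * d)"
  proof (rule sum_mono)
    fix i :: 2
    have "norm (M$i) \<le> (\<Sum>j\<in>UNIV. \<bar>M$i$j\<bar>)" by (rule norm_le_l1_cart)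
    also have "\<dots> \<le> (\<Sum>j\<in>(UNIV::2 set). d)" by (rule sum_mono) (rule assms)
    finally show "norm (M$i) \<le> 2 * d" by simp
  qed
  finally show ?thesis by simp
qed

text \<open>The imaginary parts of \<open>w\<close> and \<open>act A w\<close> bound \<open>J A w\<close>, which bounds the bottom row; the numerator
\<open>act A w * J A w\<close> is then bounded as well and bounds the top row.\<close>

lemma entries_bounded:
  assumes A: "det A = 1" and w: "w \<in> truncation M" and Aw: "act A w \<in> truncation M"
  shows "\<bar>A$i$j\<bar> \<le> M + M^2 + M^3 + M^4"
proof -
  have M: "0 < M" using truncation_pos[OF w] .
  have wH: "w \<in> \<H>" using w truncation_subset_H by blast
  have wb: "norm w < M" "1 / M < Im w" "0 < Im w" using w wH by (auto simp: truncation_def upper_half_plane_def)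
  have Awb: "norm (act A w) < M" "1 / M < Im (act A w)" using Aw by (auto simp: truncation_def)
  have n: "J A w \<noteq> 0" using J_nonzero[OF A wH] .
  have scale: "\<bar>x\<bar> \<le> M * y" if "\<bar>x\<bar> * Im w \<le> y" for x y
  proof -
    have "\<bar>x\<bar> * (1 / M) \<le> \<bar>x\<bar> * Im w" using wb by (intro mult_left_mono) auto
    then have "\<bar>x\<bar> / M \<le> y" using that by simp
    then show ?thesis using M by (simp add: pos_divide_le_eq mult.commute)
  qed
  have "1 / M < Im w / (norm (J A w))\<^sup>2" using Awb Im_act[OF A wH] by simp
  then have "(norm (J A w))\<^sup>2 < M * Im w" using M n by (simp add: field_simps)
  also have "\<dots> \<le> M * M" using wb M abs_Im_le_cmod[of w] by (intro mult_left_mono) linarith+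
  finally have "(norm (J A w))\<^sup>2 < M\<^sup>2" by (simp add: power2_eq_square)
  then have JM: "norm (J A w) \<le> M" using M by (simp add: power2_less_imp_less less_imp_le)
  have "\<bar>A$2$1\<bar> * Im w = \<bar>Im (J A w)\<bar>" using wb by (simp add: J_def abs_mult)
  then have "\<bar>A$2$1\<bar> * Im w \<le> M" using JM abs_Im_le_cmod[of "J A w"] by linarith
  then have c: "\<bar>A$2$1\<bar> \<le> M^2" using scale[of "A$2$1" M] by (simp add: power2_eq_square)
  have "\<bar>A$2$2\<bar> = norm (J A w - of_real (A$2$1) * w)" by (simp add: J_def)
  also have "\<dots> \<le> norm (J A w) + \<bar>A$2$1\<bar> * norm w" by (metis norm_triangle_ineq4 norm_mult norm_of_real)
  also have "\<dots> \<le> M + M^2 * M" using JM c wb M by (intro add_mono mult_mono) auto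
  finally have d: "\<bar>A$2$2\<bar> \<le> M + M^3" by (simp add: power2_eq_square power3_eq_cube)
  define P where "P = of_real (A$1$1) * w + of_real (A$1$2)"
  have "P = act A w * J A w" using n by (simp add: P_def act_def moebius_def J_def)
  then have "norm P \<le> M * M" using Awb JM M by (simp add: norm_mult mult_mono)
  then have PM: "norm P \<le> M^2" by (simp add: power2_eq_square)
  have "\<bar>A$1$1\<bar> * Im w = \<bar>Im P\<bar>" using wb by (simp add: P_def abs_mult)
  then have "\<bar>A$1$1\<bar> * Im w \<le> M^2" using PM abs_Im_le_cmod[of P] by linarith
  then have a: "\<bar>A$1$1\<bar> \<le> M^3" using scale[of "A$1$1" "M^2"] by (simp add: power2_eq_square power3_eq_cube)
  have "\<bar>A$1$2\<bar> = norm (P - of_real (A$1$1) * w)" by (simp add: P_def)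
  also have "\<dots> \<le> norm P + \<bar>A$1$1\<bar> * norm w" by (metis norm_triangle_ineq4 norm_mult norm_of_real)
  also have "\<dots> \<le> M^2 + M^3 * M" using PM a wb M by (intro add_mono mult_mono) auto
  finally have b: "\<bar>A$1$2\<bar> \<le> M^2 + M^4" by (simp add: power_numeral_reduce mult_ac)
  have "0 \<le> M" "0 \<le> M^2" "0 \<le> M^3" "0 \<le> M^4" using M by auto
  then have "\<bar>A$1$1\<bar> \<le> M + M^2 + M^3 + M^4" "\<bar>A$1$2\<bar> \<le> M + M^2 + M^3 + M^4"
    "\<bar>A$2$1\<bar> \<le> M + M^2 + M^3 + M^4" "\<bar>A$2$2\<bar> \<le> M + M^2 + M^3 + M^4"
    using a b c d by linarith+
  then have "\<forall>i j. \<bar>A$i$j\<bar> \<le> M + M^2 + M^3 + M^4" unfolding forall_2 by blast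
  then show ?thesis by blast
qed

text \<open>A bounded infinite set of matrices has an accumulation point, hence distinct elements \<open>A\<close>, \<open>B\<close> that
are not opposite and for which \<open>matrix_inv A ** B\<close> is as close to the identity as desired.\<close>

lemma finite_of_discrete:
  fixes G S :: "(real^2^2) set"
  assumes det: "\<And>A. A \<in> G \<Longrightarrow> det A = 1"
    and quot: "\<And>A B. A \<in> G \<Longrightarrow> B \<in> G \<Longrightarrow> matrix_inv A ** B \<in> G"
    and e: "0 < e" "\<And>A. A \<in> G \<Longrightarrow> dist A (mat 1) < e \<Longrightarrow> A = mat 1 \<or> A = - mat 1"
    and S: "S \<subseteq> G" "\<And>A i j. A \<in> S \<Longrightarrow> \<bar>A$i$j\<bar> \<le> K"
  shows "finite S"
proof (rule ccontr)
  assume inf: "infinite S"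
  then have "S \<noteq> {}" by auto
  then obtain A0 where "A0 \<in> S" by blast
  then have "\<bar>A0$1$1\<bar> \<le> K" using S by blast
  then have K: "0 \<le> K" by linarith
  have "norm A \<le> 4 * K" if "A \<in> S" for A using norm_matrix_2_le S(2)[OF that] by blast
  then have "S \<subseteq> cball 0 (4 * K)" by auto
  then obtain x where x: "x islimpt S"
    using inf compact_cball[of "0::real^2^2" "4 * K"] unfolding compact_eq_Bolzano_Weierstrass by blast
  \<comment> \<open>Four entries, each a sum of two products of an entry at most \<open>K\<close> and one at most \<open>2 * \<delta>\<close>;
    \<open>K + 1\<close> instead of \<open>K\<close> avoids division by zero.\<close>
  define \<delta> where "\<delta> = e / (16 * (K + 1))"
  have \<delta>: "0 < \<delta>" "16 * K * \<delta> < e"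
    using e(1) K by (auto simp: \<delta>_def field_simps)
  have infT: "infinite (S \<inter> ball x \<delta>)"
    using x \<delta>(1) by (simp add: islimpt_eq_infinite_ball)
  then have "S \<inter> ball x \<delta> \<noteq> {}" by (metis finite.emptyI)
  then obtain A where A: "A \<in> S" "A \<in> ball x \<delta>" by blast
  have "infinite (S \<inter> ball x \<delta> - {A, - A})" using infT by simp
  then have "S \<inter> ball x \<delta> - {A, - A} \<noteq> {}" by (metis finite.emptyI)
  then obtain B where B: "B \<in> S" "B \<in> ball x \<delta>" "B \<noteq> A" "B \<noteq> - A" by blast
  have dA: "det A = 1" using A S det by blast
  have inv: "matrix_inv A = vector [vector [A$2$2, - A$1$2], vector [- A$2$1, A$1$1]]"
    using matrix_inv_SL2[OF dA] .
  have invm: "matrix_inv A ** A = mat 1" "A ** matrix_inv A = mat 1"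
    using matrix_inverse_SL2[OF dA] matrix_inv_eqI by metis+
  have "dist A x < \<delta>" "dist B x < \<delta>" using A(2) B(2) by (simp_all add: dist_commute)
  then have "dist A B < 2 * \<delta>" using dist_triangle2[of A B x] by linarith
  then have "norm (B - A) \<le> 2 * \<delta>" by (simp add: dist_norm norm_minus_commute)
  then have ent: "\<bar>(B - A)$i$j\<bar> \<le> 2 * \<delta>" for i j
    using component_le_norm_cart[of "(B - A)$i" j] Finite_Cartesian_Product.norm_nth_le[of "B - A" i] by linarith
  have "matrix_inv A ** B - mat 1 = matrix_inv A ** (B - A)"
    by (simp add: matrix_mult_2 vec_eq_iff invm(1)[symmetric] algebra_simps)
  moreover have "\<bar>(matrix_inv A ** (B - A))$i$j\<bar> \<le> 4 * K * \<delta>" for i j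
  proof -
    have "\<forall>i k. \<bar>matrix_inv A $ i $ k\<bar> \<le> K"
      unfolding inv forall_2 using S(2)[OF A(1)] by simp
    then have I: "\<bar>matrix_inv A $ i $ k\<bar> \<le> K" for i k by blast
    have "\<bar>(matrix_inv A ** (B - A))$i$j\<bar> \<le> \<bar>matrix_inv A $ i $ 1\<bar> * \<bar>(B - A)$1$j\<bar> + \<bar>matrix_inv A $ i $ 2\<bar> * \<bar>(B - A)$2$j\<bar>"
      unfolding matrix_mult_2 abs_mult[symmetric] by (rule abs_triangle_ineq)
    also have "\<dots> \<le> K * (2 * \<delta>) + K * (2 * \<delta>)"
      using I ent K by (intro add_mono mult_mono) auto
    finally show ?thesis by simp
  qed
  ultimately have "norm (matrix_inv A ** B - mat 1) \<le> 4 * (4 * K * \<delta>)"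
    using norm_matrix_2_le by metis
  then have "dist (matrix_inv A ** B) (mat 1) < e" using \<delta>(2) by (simp add: dist_norm)
  moreover have "matrix_inv A ** B \<in> G" using quot A B S by blast
  ultimately have "matrix_inv A ** B = mat 1 \<or> matrix_inv A ** B = - mat 1" using e(2) by blast
  moreover have "B = A ** (matrix_inv A ** B)" by (simp add: matrix_mul_assoc invm)
  moreover have "A ** - mat 1 = - A" by (simp add: vec_eq_iff matrix_mult_2 forall_2 mat_def)
  ultimately show False using B by (metis matrix_mul_rid)
qed

lemma coset_PSL2R:
  assumes "C \<in> carrier PSL2R" "A \<in> C"
  shows "det A = 1" "C = {A, - A}"
proof -
  obtain B where B: "det B = 1" "C = {mat 1 ** B, (- mat 1) ** B}"
    using assms(1) by (auto simp: PSL2R_def FactGroup_def RCOSETS_def r_coset_def SL2R_def)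
  have "(- mat 1) ** B = - B" by (simp add: vec_eq_iff matrix_mult_2 forall_2 mat_def)
  then have C: "C = {B, - B}" using B by simp
  show "det A = 1" "C = {A, - A}" using assms(2) B(1) unfolding C by (auto simp: det_2)
qed

lemma matrix_neg_mult:
  fixes A B :: "real^2^2"
  shows "A ** (- B) = - (A ** B)" "(- A) ** B = - (A ** B)"
  by (simp_all add: vec_eq_iff matrix_mult_2)

lemma disjoint_PSL2R: "disjoint (carrier PSL2R)"
  unfolding disjoint_def pairwise_def disjnt_def
  using coset_PSL2R(2) by (metis disjoint_iff)

lemma lifts_group:
  assumes \<Gamma>: "subgroup \<Gamma> PSL2R"
  shows "\<And>A. A \<in> \<Union>\<Gamma> \<Longrightarrow> det A = 1" "mat 1 \<in> \<Union>\<Gamma>"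
    "\<And>A B. A \<in> \<Union>\<Gamma> \<Longrightarrow> B \<in> \<Union>\<Gamma> \<Longrightarrow> A ** B \<in> \<Union>\<Gamma>"
    "\<And>A. A \<in> \<Union>\<Gamma> \<Longrightarrow> matrix_inv A \<in> \<Union>\<Gamma>"
proof -
  interpret PSL: group PSL2R
    unfolding PSL2R_def by (rule normal.factorgroup_is_group[OF normal_SL2R_centre])
  interpret subgroup \<Gamma> PSL2R by fact
  have one: "\<one>\<^bsub>PSL2R\<^esub> = {mat 1, - mat 1}" by (simp add: PSL2R_def FactGroup_def)
  have mult: "C \<otimes>\<^bsub>PSL2R\<^esub> D = {A ** B |A B. A \<in> C \<and> B \<in> D}" for C D
    by (auto simp: PSL2R_def FactGroup_def set_mult_def SL2R_def)
  show "det A = 1" if "A \<in> \<Union>\<Gamma>" for A using that coset_PSL2R subset by blast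
  show "mat 1 \<in> \<Union>\<Gamma>" using one_closed unfolding one by blast
  show "A ** B \<in> \<Union>\<Gamma>" if AB: "A \<in> \<Union>\<Gamma>" "B \<in> \<Union>\<Gamma>" for A B
  proof -
    obtain C D where "C \<in> \<Gamma>" "D \<in> \<Gamma>" "A \<in> C" "B \<in> D" using AB by blast
    then show ?thesis using m_closed[of C D] unfolding mult by blast
  qed
  show "matrix_inv A \<in> \<Union>\<Gamma>" if A: "A \<in> \<Union>\<Gamma>" for A
  proof -
    obtain C where C: "C \<in> \<Gamma>" "A \<in> C" using A by blast
    define D where "D = inv\<^bsub>PSL2R\<^esub> C"
    have D: "D \<in> \<Gamma>" using C m_inv_closed by (simp add: D_def)
    have "C \<otimes>\<^bsub>PSL2R\<^esub> D = {mat 1, - mat 1}" 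
      unfolding D_def using C subset by (subst PSL.r_inv) (auto simp: one)
    then have "\<exists>A'\<in>C. \<exists>B\<in>D. A' ** B = mat 1" unfolding mult by (auto simp: set_eq_iff) metis
    then obtain A' B where AB: "A' \<in> C" "B \<in> D" "A' ** B = mat 1" by blast
    have "A' = A \<or> A' = - A" using coset_PSL2R(2)[of C A] C AB subset by blast
    moreover have "- B \<in> D" using coset_PSL2R(2)[of D B] D AB subset by blast
    moreover have "matrix_inv A = X" if "A ** X = mat 1" for X
      using that matrix_left_right_inverse by (intro matrix_inv_eqI) blast+
    ultimately show ?thesis
      using AB D by (metis UnionI matrix_neg_mult)
  qed
qed

text \<open>As the coset of the identity is isolated in the group, the identity matrix has a neighbourhood that
meets no other coset of the group.\<close>

lemma lifts_discrete:
  assumes "fuchsian \<Gamma>"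
  obtains e where "0 < e" "\<And>A. A \<in> \<Union>\<Gamma> \<Longrightarrow> dist A (mat 1) < e \<Longrightarrow> A = mat 1 \<or> A = - mat 1"
proof -
  have \<Gamma>: "subgroup \<Gamma> PSL2R" and disc: "subtopology PSL2R_topology \<Gamma> = discrete_topology \<Gamma>"
    using assms by (auto simp: fuchsian_def)
  let ?Z = "{mat 1, - mat 1 :: real^2^2}"
  have "?Z \<in> \<Gamma>" using subgroup.one_closed[OF \<Gamma>] by (simp add: PSL2R_def FactGroup_def)
  then have "openin (subtopology PSL2R_topology \<Gamma>) {?Z}" unfolding disc by simp
  then obtain U where U: "openin PSL2R_topology U" "{?Z} = U \<inter> \<Gamma>"
    unfolding openin_subtopology by blast
  then have U': "U \<subseteq> carrier PSL2R" "openin (top_of_set (carrier SL2R)) (\<Union>U)"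
    unfolding PSL2R_topology_def openin_partition_topology[OF disjoint_PSL2R] by auto
  then obtain T where T: "open T" "\<Union>U = carrier SL2R \<inter> T"
    unfolding openin_open by blast
  have "mat 1 \<in> \<Union>U" using U(2) by blast
  then obtain e where e: "0 < e" "ball (mat 1) e \<subseteq> T"
    using T open_contains_ball by blast
  show ?thesis
  proof (rule that[OF e(1)])
    fix A assume A: "A \<in> \<Union>\<Gamma>" "dist A (mat 1) < e"
    then obtain C where C: "C \<in> \<Gamma>" "A \<in> C" by blast
    have CP: "C \<in> carrier PSL2R" using C subgroup.subset[OF \<Gamma>] by blast
    have "A \<in> T" using A e(2) by (auto simp: dist_commute)
    moreover have "A \<in> carrier SL2R" using coset_PSL2R(1)[OF CP C(2)] by (simp add: SL2R_def)
    ultimately obtain C' where C': "C' \<in> U" "A \<in> C'" using T(2) by blast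
    have "C' \<in> carrier PSL2R" using C'(1) U'(1) by blast
    then have "C' = C" using coset_PSL2R(2)[OF _ C'(2)] coset_PSL2R(2)[OF CP C(2)] by simp
    then have "C \<in> {?Z}" using U(2) C C' by blast
    then show "A = mat 1 \<or> A = - mat 1" using C(2) by blast
  qed
qed

lemma truncation_mono: "0 < M \<Longrightarrow> M \<le> M' \<Longrightarrow> truncation M \<subseteq> truncation M'"
proof -
  assume M: "0 < M" "M \<le> M'"
  have "1 / M' \<le> 1 / M" using M by (intro divide_left_mono) auto
  then show ?thesis using M unfolding truncation_def by auto
qed

text \<open>The images of the truncations form an increasing open cover of the compact orbit space.\<close>

lemma lifts_cover:
  assumes \<Gamma>: "subgroup \<Gamma> PSL2R" and cpt: "cocompact \<Gamma>"
  obtains N where "\<And>\<tau>. \<tau> \<in> \<H> \<Longrightarrow> \<exists>A\<in>\<Union>\<Gamma>. act A \<tau> \<in> truncation N"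
proof -
  note G = lifts_group[OF \<Gamma>]
  let ?O = "orbit_of \<Gamma> ` \<H>"
  have mem: "\<tau> \<in> orbit_of \<Gamma> \<tau>" for \<tau>
  proof -
    have "act (mat 1) \<tau> \<in> orbit_of \<Gamma> \<tau>" unfolding orbit_of_def using G(2) by blast
    then show ?thesis by simp
  qed
  have orbit_eq: "orbit_of \<Gamma> (act A \<tau>) = orbit_of \<Gamma> \<tau>" if A: "A \<in> \<Union>\<Gamma>" and \<tau>: "\<tau> \<in> \<H>" for A \<tau>
  proof
    show "orbit_of \<Gamma> (act A \<tau>) \<subseteq> orbit_of \<Gamma> \<tau>"
    proof
      fix z assume "z \<in> orbit_of \<Gamma> (act A \<tau>)"
      then obtain B where B: "B \<in> \<Union>\<Gamma>" "z = act B (act A \<tau>)" unfolding orbit_of_def by blast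
      then have "z = act (B ** A) \<tau>" using G(1)[OF A] G(1)[OF B(1)] \<tau> by (simp add: act_mult)
      then show "z \<in> orbit_of \<Gamma> \<tau>" unfolding orbit_of_def using G(3)[OF B(1) A] by blast
    qed
    show "orbit_of \<Gamma> \<tau> \<subseteq> orbit_of \<Gamma> (act A \<tau>)"
    proof
      fix z assume "z \<in> orbit_of \<Gamma> \<tau>"
      then obtain B where B: "B \<in> \<Union>\<Gamma>" "z = act B \<tau>" unfolding orbit_of_def by blast
      have i: "matrix_inv A ** A = mat 1"
        using matrix_inverse_SL2[OF G(1)[OF A]] matrix_inv_eqI by metis
      have m: "B ** matrix_inv A \<in> \<Union>\<Gamma>" using G(3,4) A B by blast
      have "act (B ** matrix_inv A) (act A \<tau>) = act (B ** matrix_inv A ** A) \<tau>"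
        using G(1)[OF m] G(1)[OF A] \<tau> by (simp add: act_mult)
      also have "\<dots> = z" by (simp add: i B flip: matrix_mul_assoc)
      finally show "z \<in> orbit_of \<Gamma> (act A \<tau>)" unfolding orbit_of_def using m by blast
    qed
  qed
  have orbit_H: "orbit_of \<Gamma> \<tau> \<subseteq> \<H>" if "\<tau> \<in> \<H>" for \<tau>
    unfolding orbit_of_def using act_in_H G(1) that by blast
  have orbit_mem: "orbit_of \<Gamma> z = orbit_of \<Gamma> \<tau>" if z: "z \<in> orbit_of \<Gamma> \<tau>" and \<tau>: "\<tau> \<in> \<H>" for z \<tau>
  proof -
    obtain A where "A \<in> \<Union>\<Gamma>" "z = act A \<tau>" using z unfolding orbit_of_def by blast
    then show ?thesis using orbit_eq \<tau> by simp
  qed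
  have disj: "disjoint ?O"
  proof (rule disjointI)
    fix C D assume "C \<in> ?O" "D \<in> ?O" "C \<noteq> D"
    then show "C \<inter> D = {}" using orbit_mem by blast
  qed
  have openin_iff: "openin (orbit_space \<Gamma>) U \<longleftrightarrow> U \<subseteq> ?O \<and> open (\<Union>U)" for U
  proof -
    have "U \<subseteq> ?O \<Longrightarrow> \<Union>U \<subseteq> \<H>" using orbit_H by blast
    then show ?thesis
      unfolding orbit_space_def openin_partition_topology[OF disj]
      using openin_open_eq[OF open_H] by auto
  qed
  have top: "topspace (orbit_space \<Gamma>) = ?O"
  proof
    show "topspace (orbit_space \<Gamma>) \<subseteq> ?O" using openin_iff[of "topspace (orbit_space \<Gamma>)"] by auto
    have "\<Union>?O = \<H>" using mem orbit_H by blast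
    then have "openin (orbit_space \<Gamma>) ?O" using openin_iff open_H by simp
    then show "?O \<subseteq> topspace (orbit_space \<Gamma>)" by (rule openin_subset)
  qed
  define U where "U = (\<lambda>n::nat. {C \<in> ?O. C \<inter> truncation (real (Suc n)) \<noteq> {}})"
  have "openin (orbit_space \<Gamma>) (U n)" for n
  proof -
    have "\<Union>(U n) = (\<Union>A\<in>\<Union>\<Gamma>. \<H> \<inter> act A -` truncation (real (Suc n)))"
    proof
      show "\<Union>(U n) \<subseteq> (\<Union>A\<in>\<Union>\<Gamma>. \<H> \<inter> act A -` truncation (real (Suc n)))"
      proof
        fix z assume "z \<in> \<Union>(U n)"
        then obtain \<tau> w where \<tau>: "\<tau> \<in> \<H>" "z \<in> orbit_of \<Gamma> \<tau>" "w \<in> orbit_of \<Gamma> \<tau>" "w \<in> truncation (real (Suc n))"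
          unfolding U_def by blast
        then have "w \<in> orbit_of \<Gamma> z" "z \<in> \<H>" using orbit_mem orbit_H by blast+
        then show "z \<in> (\<Union>A\<in>\<Union>\<Gamma>. \<H> \<inter> act A -` truncation (real (Suc n)))"
          using \<tau>(4) unfolding orbit_of_def by blast
      qed
      show "(\<Union>A\<in>\<Union>\<Gamma>. \<H> \<inter> act A -` truncation (real (Suc n))) \<subseteq> \<Union>(U n)"
      proof
        fix z assume "z \<in> (\<Union>A\<in>\<Union>\<Gamma>. \<H> \<inter> act A -` truncation (real (Suc n)))"
        then obtain A where A: "A \<in> \<Union>\<Gamma>" "z \<in> \<H>" "act A z \<in> truncation (real (Suc n))" by blast
        then have "act A z \<in> orbit_of \<Gamma> z" unfolding orbit_of_def by blast
        then have "orbit_of \<Gamma> z \<in> U n" using A unfolding U_def by blast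
        then show "z \<in> \<Union>(U n)" using mem by blast
      qed
    qed
    moreover have "open (\<H> \<inter> act A -` truncation (real (Suc n)))" if "A \<in> \<Union>\<Gamma>" for A
    proof (rule continuous_open_preimage[OF _ open_H open_truncation])
      show "continuous_on \<H> (act A)"
        using has_field_derivative_act[OF G(1)[OF that]]
        by (meson DERIV_isCont continuous_at_imp_continuous_on)
    qed
    then have "open (\<Union>A\<in>\<Union>\<Gamma>. \<H> \<inter> act A -` truncation (real (Suc n)))" by (intro open_UN ballI)
    ultimately have "open (\<Union>(U n))" by (simp only:)
    moreover have "U n \<subseteq> ?O" unfolding U_def by blast
    ultimately show ?thesis unfolding openin_iff by blast
  qed
  moreover have "topspace (orbit_space \<Gamma>) \<subseteq> \<Union>(range U)"
  proof
    fix C assume "C \<in> topspace (orbit_space \<Gamma>)"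
    then obtain \<tau> where \<tau>: "\<tau> \<in> \<H>" "C = orbit_of \<Gamma> \<tau>" using top by blast
    obtain n :: nat where n: "max (norm \<tau>) (1 / Im \<tau>) < real n" using reals_Archimedean2 by blast
    have y: "0 < Im \<tau>" using \<tau> by (simp add: upper_half_plane_def)
    have "norm \<tau> < real (Suc n)" "1 / Im \<tau> < real (Suc n)" using n by simp_all
    then have "1 / real (Suc n) < Im \<tau>" using y by (simp add: field_simps)
    then have "\<tau> \<in> truncation (real (Suc n))" using \<open>norm \<tau> < real (Suc n)\<close> by (simp add: truncation_def)
    then show "C \<in> \<Union>(range U)" using \<tau> mem[of \<tau>] unfolding U_def by blast
  qed
  ultimately obtain F where F: "finite F" "F \<subseteq> range U" "?O \<subseteq> \<Union>F"
    using cpt unfolding cocompact_def compact_space_alt top by (metis (no_types, lifting) rangeE)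
  then obtain I where I: "finite I" "F = U ` I" by (meson finite_subset_image)
  define N where "N = real (Suc (Max (insert 0 I)))"
  show ?thesis
  proof (rule that)
    fix \<tau> assume \<tau>: "\<tau> \<in> \<H>"
    then obtain n where n: "n \<in> I" "orbit_of \<Gamma> \<tau> \<in> U n" using F(3) I by blast
    then obtain A where "A \<in> \<Union>\<Gamma>" "act A \<tau> \<in> truncation (real (Suc n))"
      unfolding U_def orbit_of_def by blast
    moreover have "n \<le> Max (insert 0 I)" using I n by simp
    then have "truncation (real (Suc n)) \<subseteq> truncation N"
      unfolding N_def by (intro truncation_mono) simp_all
    ultimately show "\<exists>A\<in>\<Union>\<Gamma>. act A \<tau> \<in> truncation N" by blast
  qed
qed

lemma cocompact_lattice_lifts:
  assumes "fuchsian \<Gamma>" "cocompact \<Gamma>"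
  obtains N where "cocompact_lattice (\<Union>\<Gamma>) N"
proof -
  have \<Gamma>: "subgroup \<Gamma> PSL2R" using assms by (simp add: fuchsian_def)
  note G = lifts_group[OF \<Gamma>]
  obtain e where e: "0 < e" "\<And>A. A \<in> \<Union>\<Gamma> \<Longrightarrow> dist A (mat 1) < e \<Longrightarrow> A = mat 1 \<or> A = - mat 1"
    using lifts_discrete[OF assms(1)] by metis
  obtain N where N: "\<And>\<tau>. \<tau> \<in> \<H> \<Longrightarrow> \<exists>A\<in>\<Union>\<Gamma>. act A \<tau> \<in> truncation N"
    using lifts_cover[OF \<Gamma> assms(2)] by metis
  have "cocompact_lattice (\<Union>\<Gamma>) N"
  proof
    fix M
    show "finite {A \<in> \<Union>\<Gamma>. \<exists>w\<in>truncation M. act A w \<in> truncation M}"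
    proof (rule finite_of_discrete[OF G(1) _ e])
      show "matrix_inv A ** B \<in> \<Union>\<Gamma>" if "A \<in> \<Union>\<Gamma>" "B \<in> \<Union>\<Gamma>" for A B using G(3,4) that by blast
      show "\<bar>A$i$j\<bar> \<le> M + M^2 + M^3 + M^4"
        if "A \<in> {A \<in> \<Union>\<Gamma>. \<exists>w\<in>truncation M. act A w \<in> truncation M}" for A i j
        using that entries_bounded G(1) by blast
    qed auto
  qed (use G N in auto)
  then show ?thesis by (rule that)
qed

section \<open>Quasi-automorphic forms of weight two\<close>

theorem theorem2p6:
  fixes \<Gamma> :: "(real^2^2) set set" and g :: nat
  assumes "fuchsian \<Gamma>" and "cocompact \<Gamma>"
    and "has_genus (orbit_space \<Gamma>) g" and "g \<ge> 2"
  shows "(\<forall>c::complex. c \<noteq> 0 \<longrightarrow>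
           \<not> (\<exists>E. E holomorphic_on \<H> \<and>
                (\<forall>\<gamma>\<in>\<Union>\<Gamma>. \<forall>\<tau>\<in>\<H>. slash 2 E \<gamma> \<tau> = E \<tau> + c * X_cocycle \<gamma> \<tau>)))
       \<and> (\<forall>f\<in>quasi_automorphic_forms 2 \<Gamma>. \<forall>s Q. quasi_expansion 2 \<Gamma> f s Q \<longrightarrow> 1 \<le> s \<longrightarrow>
           (\<forall>\<tau>\<in>\<H>. Q 1 \<tau> = 0))
       \<and> quasi_automorphic_forms 2 \<Gamma> = automorphic_forms 2 \<Gamma>"
proof -
  obtain N where "cocompact_lattice (\<Union>\<Gamma>) N" using cocompact_lattice_lifts[OF assms(1,2)] .
  then interpret L: cocompact_lattice "\<Union>\<Gamma>" N .
  have vanish: "Q m \<tau> = 0"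
    if "f holomorphic_on \<H>" "quasi_expansion 2 \<Gamma> f s Q" "1 \<le> m" "m \<le> s" "\<tau> \<in> \<H>" for f s Q m \<tau>
    using L.quasi_coefficients_vanish[of f s Q m \<tau>] that unfolding quasi_expansion_def by blast
  have "\<not> (\<exists>E. E holomorphic_on \<H> \<and>
          (\<forall>\<gamma>\<in>\<Union>\<Gamma>. \<forall>\<tau>\<in>\<H>. slash 2 E \<gamma> \<tau> = E \<tau> + c * X_cocycle \<gamma> \<tau>))" if c: "c \<noteq> 0" for c :: complex
  proof clarify
    fix E assume E: "E holomorphic_on \<H>"
      and law: "\<forall>\<gamma>\<in>\<Union>\<Gamma>. \<forall>\<tau>\<in>\<H>. slash 2 E \<gamma> \<tau> = E \<tau> + c * X_cocycle \<gamma> \<tau>"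
    show False
    proof (rule L.no_quasiautomorphic_cocycle[of "\<lambda>\<tau>. E \<tau> / c"])
      show "(\<lambda>\<tau>. E \<tau> / c) holomorphic_on \<H>" using E c by (intro holomorphic_intros) auto
      show "slash 2 (\<lambda>\<tau>. E \<tau> / c) A \<tau> = E \<tau> / c + X_cocycle A \<tau>" if "A \<in> \<Union>\<Gamma>" "\<tau> \<in> \<H>" for A \<tau>
      proof -
        have "slash 2 E A \<tau> = E \<tau> + c * X_cocycle A \<tau>" using law that by blast
        moreover have "slash 2 (\<lambda>\<tau>. E \<tau> / c) A \<tau> = slash 2 E A \<tau> / c" by (simp add: slash_2)
        ultimately show ?thesis using c by (simp add: add_divide_distrib)
      qed
    qed
  qed
  moreover have "Q 1 \<tau> = 0"
    if "f \<in> quasi_automorphic_forms 2 \<Gamma>" "quasi_expansion 2 \<Gamma> f s Q" "1 \<le> s" "\<tau> \<in> \<H>" for f s Q \<tau>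
    using vanish[of f s Q 1 \<tau>] that by (simp add: quasi_automorphic_forms_def)
  moreover have "quasi_automorphic_forms 2 \<Gamma> = automorphic_forms 2 \<Gamma>"
  proof
    show "quasi_automorphic_forms 2 \<Gamma> \<subseteq> automorphic_forms 2 \<Gamma>"
    proof
      fix f assume "f \<in> quasi_automorphic_forms 2 \<Gamma>"
      then obtain s Q where f: "f holomorphic_on \<H>" and sQ: "quasi_expansion 2 \<Gamma> f s Q"
        by (auto simp: quasi_automorphic_forms_def)
      have law: "slash 2 f A \<tau> = Q 0 \<tau>" if "A \<in> \<Union>\<Gamma>" "\<tau> \<in> \<H>" for A \<tau>
      proof -
        have "slash 2 f A \<tau> = (\<Sum>m\<le>s. X_cocycle A \<tau> ^ m * Q m \<tau>)"
          using sQ that unfolding quasi_expansion_def by blast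
        also have "\<dots> = (\<Sum>m\<in>{0}. X_cocycle A \<tau> ^ m * Q m \<tau>)"
          by (rule sum.mono_neutral_right) (use vanish[OF f sQ _ _ that(2)] in auto)
        finally show ?thesis by simp
      qed
      have "slash 2 f A \<tau> = f \<tau>" if "A \<in> \<Union>\<Gamma>" "\<tau> \<in> \<H>" for A \<tau>
        using law[OF that] law[OF L.one_G that(2)] by (simp add: slash_2)
      then show "f \<in> automorphic_forms 2 \<Gamma>"
        using f unfolding automorphic_forms_def by blast
    qed
    show "automorphic_forms 2 \<Gamma> \<subseteq> quasi_automorphic_forms 2 \<Gamma>"
    proof
      fix f assume f: "f \<in> automorphic_forms 2 \<Gamma>"
      then have "quasi_expansion 2 \<Gamma> f 0 (\<lambda>_. f)"
        by (simp add: automorphic_forms_def quasi_expansion_def)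
      then show "f \<in> quasi_automorphic_forms 2 \<Gamma>"
        using f by (auto simp: automorphic_forms_def quasi_automorphic_forms_def)
    qed
  qed
  ultimately show ?thesis by blast
qed

end
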